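(* For all $x\ge0$, $$V_c(x)=\sup_{\pi=(\ell,G)\in\Pi_c^0}\mathbb{E}_x\left[\int_0^\infty\mathrm{e}^{-qt}(\ell_t\,\mathrm{d}t-\beta\,\mathrm{d}G_t)\right]$$ and $$V(x)=\sup_{\pi=(\ell,G)\in\Pi^0}\mathbb{E}_x\left[\int_0^{T^\pi}\mathrm{e}^{-qt}(\ell_t\,\mathrm{d}t-\beta\,\mathrm{d}G_t)\right].$$
   Context: Setting. Let $(\Omega,\mathcal{F},\mathbb{F}=\{\mathcal{F}_t,t\ge0\},\mathbb{P})$ be a filtered probability space with a standard Brownian motion $B$. Fix $\mu\in\mathbb{R}$, $\sigma>0$, a discount rate $q>0$, a cost $\beta>1$, and a nondecreasing, concave, continuously differentiable function $F:\mathbb{R}_+\to\mathbb{R}_+$ (so $F(0)\ge0$). Let $X_t=X_0+\mu t+\sigma B_t$. Strategies. A control strategy is a pair $\pi=(\ell,G)$ of adapted processes, with $G$ nondecreasing, right-continuous and $G_{0-}=0$. The controlled process is $\mathrm{d}X^\pi_t=(\mu-\ell_t)\mathrm{d}t+\sigma\mathrm{d}B_t+\mathrm{d}G_t$, $X^\pi_{0-}=X_0$, and $T^\pi=\inf\{t>0: X^\pi_t<0\}$. The strategy is admissible, $\pi\in\Pi$, if $\ell_t\ge0$ for all $t\ge0$ and $\ell_t\le F(X^\pi_t)$ for all $0\le t\le T^\pi$ (with $t<\infty$). $\mathbb{E}_x$ denotes expectation given $X^\pi_{0-}=X_0=x\ge0$. The performance function is $J(x;\pi)=\mathbb{E}_x\left[\int_0^{T^\pi}\mathrm{e}^{-qt}(\ell_t\,\mathrm{d}t-\beta\,\mathrm{d}G_t)\right]$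 (a jump of $G$ at time $0$ is counted in the integral). Value functions, for $x\ge0$: $V(x)=\sup_{\pi\in\Pi}J(x;\pi)$ and $V_c(x)=\sup_{\pi\in\Pi_c}J(x;\pi)$, where $\Pi_c=\{\pi\in\Pi: X^\pi_t\ge0\ \text{for all }t\ge0\}$. Bail-out classes. For a dividend rate process $\ell$, let $\underline{G}^\ell_t=-\min\{X^{(\ell,0)}_s\wedge0: 0\le s\le t\}$, where $X^{(\ell,0)}$ is the controlled process without injections. Let $\mathcal{T}$ be the set of all $\mathbb{F}$-stopping times. Then $\Pi_c^0=\{\pi=(\ell,G)\in\Pi_c: G_t=\underline{G}^\ell_t\ \text{for all }t\ge0\}$ and $\Pi^0=\{\pi=(\ell,G)\in\Pi: \text{there exists }\tau\in\mathcal{T}\text{ such that }G_t=\underline{G}^\ell_{t\wedge\tau}\text{ for all }t\ge0\}$. *)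

theory Defs
  imports "HOL-Probability.Probability"
begin

text \<open>
  Time is \<open>[0, \<infinity>)\<close>: processes and filtrations are indexed by \<^typ>\<open>real\<close>, and only nonnegative
  indices matter, except that injection processes are set to \<open>0\<close> at negative times (see
  \<open>control\<close>). Random times have values in \<open>[0, \<infinity>]\<close>, i.e. in \<^typ>\<open>ennreal\<close>.
\<close>

type_synonym 'a process = "real \<Rightarrow> 'a \<Rightarrow> real"

definition filtered_prob_space :: "'a measure \<Rightarrow> (real \<Rightarrow> 'a measure) \<Rightarrow> bool" where
  "filtered_prob_space M \<FF> \<longleftrightarrow>
     prob_space M \<and> filtration (space M) \<FF> \<and> (\<forall>t. subalgebra M (\<FF> t))"

definition adapted :: "(real \<Rightarrow> 'a measure) \<Rightarrow> 'a process \<Rightarrow> bool" where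
  "adapted \<FF> Y \<longleftrightarrow> (\<forall>t\<ge>0. Y t \<in> borel_measurable (\<FF> t))"

text \<open>Implies \<open>adapted\<close>, and makes \<open>\<integral>\<^sub>0\<^sup>t Y\<^sub>s ds\<close> adapted as well.\<close>

definition progressively_measurable :: "(real \<Rightarrow> 'a measure) \<Rightarrow> 'a process \<Rightarrow> bool" where
  "progressively_measurable \<FF> Y \<longleftrightarrow>
     (\<forall>t\<ge>0. (\<lambda>(s, \<omega>). Y s \<omega>) \<in> borel_measurable (restrict_space borel {0..t} \<Otimes>\<^sub>M \<FF> t))"

definition brownian_motion ::
    "'a measure \<Rightarrow> (real \<Rightarrow> 'a measure) \<Rightarrow> 'a process \<Rightarrow> bool" where
  "brownian_motion M \<FF> B \<longleftrightarrow>
     adapted \<FF> B \<and>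
     (\<forall>\<omega>\<in>space M. B 0 \<omega> = 0 \<and> continuous_on {0..} (\<lambda>t. B t \<omega>)) \<and>
     (\<forall>s t. 0 \<le> s \<and> s < t \<longrightarrow>
        distributed M lborel (\<lambda>\<omega>. B t \<omega> - B s \<omega>) (normal_density 0 (sqrt (t - s))) \<and>
        prob_space.indep_set M
          (sets (vimage_algebra (space M) (\<lambda>\<omega>. B t \<omega> - B s \<omega>) borel)) (sets (\<FF> s)))"

text \<open>Stopping times with values in \<open>[0, \<infinity>]\<close>; the library's \<open>stopping_time\<close> would force the times to
  be of the index type of the filtration, hence finite.\<close>

definition ext_stopping_time :: "(real \<Rightarrow> 'a measure) \<Rightarrow> ('a \<Rightarrow> ennreal) \<Rightarrow> bool" where
  "ext_stopping_time \<FF> \<tau> \<longleftrightarrow> (\<forall>t\<ge>0. Measurable.pred (\<FF> t) (\<lambda>\<omega>. \<tau> \<omega> \<le> ennreal t))"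

definition C1_on_nonneg :: "(real \<Rightarrow> real) \<Rightarrow> bool" where
  "C1_on_nonneg F \<longleftrightarrow>
     (\<exists>F'. continuous_on {0..} F' \<and> (\<forall>x\<ge>0. (F has_real_derivative F' x) (at x within {0..})))"


section \<open>Controlled process and performance\<close>

definition state ::
    "'a process \<Rightarrow> real \<Rightarrow> real \<Rightarrow> real \<Rightarrow> 'a process \<Rightarrow> 'a process \<Rightarrow> 'a process" where
  "state B \<mu> \<sigma> x l G t \<omega> = x + (LBINT s:{0..t}. \<mu> - l s \<omega>) + \<sigma> * B t \<omega> + G t \<omega>"

text \<open>The infimum of the empty set is \<open>\<infinity>\<close>.\<close>

definition ruin_time ::
    "'a process \<Rightarrow> real \<Rightarrow> real \<Rightarrow> real \<Rightarrow> 'a process \<Rightarrow> 'a process \<Rightarrow> 'a \<Rightarrow> ennreal" where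
  "ruin_time B \<mu> \<sigma> x l G \<omega> = (INF t\<in>{t. 0 < t \<and> state B \<mu> \<sigma> x l G t \<omega> < 0}. ennreal t)"

definition discounted_dividends :: "real \<Rightarrow> 'a process \<Rightarrow> ennreal \<Rightarrow> 'a \<Rightarrow> ennreal" where
  "discounted_dividends q l T \<omega> =
     (\<integral>\<^sup>+ t\<in>{t. 0 \<le> t \<and> ennreal t \<le> T}. ennreal (exp (- q * t) * l t \<omega>) \<partial>lborel)"

text \<open>Since \<open>G\<close> vanishes at negative times, the Stieltjes measure has an atom of mass \<open>G\<^sub>0\<close> at \<open>0\<close>.\<close>

definition discounted_injections :: "real \<Rightarrow> 'a process \<Rightarrow> ennreal \<Rightarrow> 'a \<Rightarrow> ennreal" where
  "discounted_injections q G T \<omega> =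
     (\<integral>\<^sup>+ t\<in>{t. 0 \<le> t \<and> ennreal t \<le> T}. ennreal (exp (- q * t)) \<partial>interval_measure (\<lambda>t. G t \<omega>))"

text \<open>
  \<open>\<integral>\<^sub>0\<^sup>T e\<^sup>-\<^sup>q\<^sup>t (l\<^sub>t dt - \<beta> dG\<^sub>t)\<close> and its expectation. A strategy for which an expression of the form
  \<open>\<infinity> - \<infinity>\<close> arises is given the value \<open>-\<infinity>\<close>; the case distinctions are needed because
  \<open>\<infinity> - \<infinity> = \<infinity>\<close> in \<^typ>\<open>ereal\<close>.
\<close>

definition net_payoff ::
    "real \<Rightarrow> real \<Rightarrow> 'a process \<Rightarrow> 'a process \<Rightarrow> ennreal \<Rightarrow> 'a \<Rightarrow> ereal" where
  "net_payoff q \<beta> l G T \<omega> =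
     (if discounted_injections q G T \<omega> = \<infinity> then - \<infinity>
      else enn2ereal (discounted_dividends q l T \<omega>)
         - ereal \<beta> * enn2ereal (discounted_injections q G T \<omega>))"

definition ereal_expectation :: "'a measure \<Rightarrow> ('a \<Rightarrow> ereal) \<Rightarrow> ereal" where
  "ereal_expectation M Z =
     (if (\<integral>\<^sup>+ \<omega>. e2ennreal (- Z \<omega>) \<partial>M) = \<infinity> then - \<infinity>
      else enn2ereal (\<integral>\<^sup>+ \<omega>. e2ennreal (Z \<omega>) \<partial>M) - enn2ereal (\<integral>\<^sup>+ \<omega>. e2ennreal (- Z \<omega>) \<partial>M))"

definition performance ::
    "'a measure \<Rightarrow> 'a process \<Rightarrow> real \<Rightarrow> real \<Rightarrow> real \<Rightarrow> real \<Rightarrow> real \<Rightarrow>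
     'a process \<Rightarrow> 'a process \<Rightarrow> ereal" where
  "performance M B \<mu> \<sigma> q \<beta> x l G =
     ereal_expectation M (\<lambda>\<omega>. net_payoff q \<beta> l G (ruin_time B \<mu> \<sigma> x l G \<omega>) \<omega>)"


section \<open>Strategies\<close>

text \<open>
  Pairs of a dividend rate and an injection process. Pathwise requirements are imposed for every
  \<open>\<omega>\<close>. Local integrability of \<open>l\<close> is what makes the controlled process well defined, and
  \<open>G\<^sub>0\<^sub>- = 0\<close> is encoded by \<open>G\<^sub>t = 0\<close> for \<open>t < 0\<close>.
\<close>

definition control :: "'a measure \<Rightarrow> (real \<Rightarrow> 'a measure) \<Rightarrow> 'a process \<Rightarrow> 'a process \<Rightarrow> bool" where
  "control M \<FF> l G \<longleftrightarrow>
     progressively_measurable \<FF> l \<and> adapted \<FF> G \<and>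
     (\<forall>\<omega>\<in>space M.
        (\<forall>t\<ge>0. set_integrable lborel {0..t} (\<lambda>s. l s \<omega>)) \<and>
        (\<forall>t<0. G t \<omega> = 0) \<and> mono (\<lambda>t. G t \<omega>) \<and>
        (\<forall>t. continuous (at_right t) (\<lambda>t. G t \<omega>)))"

text \<open>\<open>\<Pi>\<close> and \<open>\<Pi>\<^sub>c\<close>, for the initial value \<open>x\<close>.\<close>

definition admissible ::
    "'a measure \<Rightarrow> (real \<Rightarrow> 'a measure) \<Rightarrow> 'a process \<Rightarrow> real \<Rightarrow> real \<Rightarrow> (real \<Rightarrow> real) \<Rightarrow> real \<Rightarrow>
     ('a process \<times> 'a process) set" where
  "admissible M \<FF> B \<mu> \<sigma> F x = {(l, G). control M \<FF> l G \<and>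
     (\<forall>\<omega>\<in>space M. \<forall>t\<ge>0. 0 \<le> l t \<omega> \<and>
        (ennreal t \<le> ruin_time B \<mu> \<sigma> x l G \<omega> \<longrightarrow> l t \<omega> \<le> F (state B \<mu> \<sigma> x l G t \<omega>)))}"

definition admissible_c ::
    "'a measure \<Rightarrow> (real \<Rightarrow> 'a measure) \<Rightarrow> 'a process \<Rightarrow> real \<Rightarrow> real \<Rightarrow> (real \<Rightarrow> real) \<Rightarrow> real \<Rightarrow>
     ('a process \<times> 'a process) set" where
  "admissible_c M \<FF> B \<mu> \<sigma> F x = {(l, G) \<in> admissible M \<FF> B \<mu> \<sigma> F x.
     \<forall>\<omega>\<in>space M. \<forall>t\<ge>0. 0 \<le> state B \<mu> \<sigma> x l G t \<omega>}"

text \<open>The injection process \<open>\<underline>G\<^sup>l\<close>; the infimum is attained, as paths without injections are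
  continuous.\<close>

definition min_injection ::
    "'a process \<Rightarrow> real \<Rightarrow> real \<Rightarrow> real \<Rightarrow> 'a process \<Rightarrow> 'a process" where
  "min_injection B \<mu> \<sigma> x l t \<omega> =
     - (INF s\<in>{0..t}. min (state B \<mu> \<sigma> x l (\<lambda>_ _. 0) s \<omega>) 0)"

text \<open>\<open>\<Pi>\<^sub>c\<^sup>0\<close> and \<open>\<Pi>\<^sup>0\<close>.\<close>

definition bailout_c ::
    "'a measure \<Rightarrow> (real \<Rightarrow> 'a measure) \<Rightarrow> 'a process \<Rightarrow> real \<Rightarrow> real \<Rightarrow> (real \<Rightarrow> real) \<Rightarrow> real \<Rightarrow>
     ('a process \<times> 'a process) set" where
  "bailout_c M \<FF> B \<mu> \<sigma> F x = {(l, G) \<in> admissible_c M \<FF> B \<mu> \<sigma> F x.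
     \<forall>\<omega>\<in>space M. \<forall>t\<ge>0. G t \<omega> = min_injection B \<mu> \<sigma> x l t \<omega>}"

definition bailout ::
    "'a measure \<Rightarrow> (real \<Rightarrow> 'a measure) \<Rightarrow> 'a process \<Rightarrow> real \<Rightarrow> real \<Rightarrow> (real \<Rightarrow> real) \<Rightarrow> real \<Rightarrow>
     ('a process \<times> 'a process) set" where
  "bailout M \<FF> B \<mu> \<sigma> F x = {(l, G) \<in> admissible M \<FF> B \<mu> \<sigma> F x.
     \<exists>\<tau>. ext_stopping_time \<FF> \<tau> \<and>
       (\<forall>\<omega>\<in>space M. \<forall>t\<ge>0.
          G t \<omega> = min_injection B \<mu> \<sigma> x l (enn2real (min (ennreal t) (\<tau> \<omega>))) \<omega>)}"

definition value_fn ::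
    "'a measure \<Rightarrow> (real \<Rightarrow> 'a measure) \<Rightarrow> 'a process \<Rightarrow> real \<Rightarrow> real \<Rightarrow> real \<Rightarrow> real \<Rightarrow>
     (real \<Rightarrow> real) \<Rightarrow> real \<Rightarrow> ereal" where
  "value_fn M \<FF> B \<mu> \<sigma> q \<beta> F x =
     (SUP (l, G)\<in>admissible M \<FF> B \<mu> \<sigma> F x. performance M B \<mu> \<sigma> q \<beta> x l G)"

definition value_fn_c ::
    "'a measure \<Rightarrow> (real \<Rightarrow> 'a measure) \<Rightarrow> 'a process \<Rightarrow> real \<Rightarrow> real \<Rightarrow> real \<Rightarrow> real \<Rightarrow>
     (real \<Rightarrow> real) \<Rightarrow> real \<Rightarrow> ereal" where
  "value_fn_c M \<FF> B \<mu> \<sigma> q \<beta> F x =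
     (SUP (l, G)\<in>admissible_c M \<FF> B \<mu> \<sigma> F x. performance M B \<mu> \<sigma> q \<beta> x l G)"

end

theory Submission
  imports Defs
begin

text \<open>
  Each right-hand side is at most the left-hand side, because its supremum is over fewer
  strategies. For the converse, an arbitrary admissible strategy \<open>(l, G)\<close> with state \<open>X\<close> and ruin
  time \<open>T\<close> is replaced by a bail-out strategy that pays at least as much, up to an arbitrarily
  small loss. Postponing an injection until the state would otherwise become negative is cheaper,
  but it lowers the state, so that the rate \<open>l\<close> may no longer be allowed. The new rate is
  therefore the largest allowed rate not above \<open>l\<close>: it solves \<open>l'\<^sub>t = min l\<^sub>t (F (X'\<^sub>t))\<close> up to
  time \<open>T\<close>, where \<open>X'\<close> is the state under \<open>l'\<close> and the minimal injections \<open>G'\<close> that keep it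
  nonnegative, i.e. a reflected path. Since \<open>F\<close> is nondecreasing and concave with finite slope
  at \<open>0\<close>, it is Lipschitz, and so is the
  reflection map; Picard iteration solves the equation for each path, and its iterates are
  progressively measurable (\<open>capped_rate_fixpoint\<close>, \<open>progressively_measurable_capped_rate\<close>).

  The heart of the argument is that \<open>X' \<le> X\<close> on \<open>[0, T]\<close> (\<open>reflected_le_controlled\<close>). If
  \<open>X'\<close> were above \<open>X \<ge> 0\<close> on an interval, then there \<open>F (X') \<ge> F (X) \<ge> l\<close>, hence \<open>l' = l\<close>, and
  \<open>G'\<close> would be constant because \<open>X' > 0\<close>; so \<open>X' - X\<close> could not have grown. In terms of money,
  with \<open>L\<close> and \<open>L'\<close> the accumulated dividends, \<open>X' \<le> X\<close> says \<open>L + G' \<le> L' + G\<close>; as \<open>L' \<le> L\<close>,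
  also \<open>G' \<le> G\<close>. These inequalities between accumulated amounts carry over to discounted
  ones, because \<open>\<integral> e\<^sup>-\<^sup>q\<^sup>t dA\<^sub>t = \<integral> q e\<^sup>-\<^sup>q\<^sup>s A\<^sub>s ds\<close> is a positive average of \<open>A\<close>
  (\<open>nn_integral_discount\<close>). Adding \<open>\<beta> - 1\<close> times the second inequality to the first one compares
  the payoffs of the two strategies path by path.

  If the state is never negative, \<open>T\<close> is infinite, and this proves the first claim. In general
  \<open>T\<close> is a hitting time of an open set; the event \<open>T \<le> t\<close> may depend on the immediate
  future of \<open>t\<close>, so that \<open>T\<close> need not be a stopping time. Injections therefore go on a little
  after \<open>T\<close>, until another \<open>\<epsilon>\<close> has been spent. That is a hitting time of a
  closed set by a continuous adapted process, hence a stopping time, and it costs at most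
  \<open>\<beta> \<epsilon>\<close> (\<open>excess_time_stopping\<close>, \<open>payoff_le\<close>). The loss vanishes as \<open>\<epsilon>\<close> tends to \<open>0\<close>.
\<close>

section \<open>Reflection of a path at zero\<close>

text \<open>
  The least nondecreasing nonnegative amount that has to be added to a path to keep it nonnegative.
  With a continuous path, adding it is the Skorokhod reflection at \<open>0\<close>.
\<close>

definition shortfall :: "(real \<Rightarrow> real) \<Rightarrow> real \<Rightarrow> real" where
  "shortfall w t = - (INF s\<in>{0..t}. min (w s) 0)"

definition reflected :: "(real \<Rightarrow> real) \<Rightarrow> real \<Rightarrow> real" where
  "reflected w t = w t + shortfall w t"

lemma shortfall_attained:
  assumes w: "continuous_on {0..} w" and t: "0 \<le> t"
  obtains s where "s \<in> {0..t}" "shortfall w t = - min (w s) 0"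
    "\<And>u. u \<in> {0..t} \<Longrightarrow> - min (w u) 0 \<le> shortfall w t"
proof -
  have "continuous_on {0..t} (\<lambda>s. min (w s) 0)"
    by (intro continuous_intros continuous_on_subset[OF w]) auto
  then obtain s where s: "s \<in> {0..t}" "\<And>u. u \<in> {0..t} \<Longrightarrow> min (w s) 0 \<le> min (w u) 0"
    using continuous_attains_inf[of "{0..t}" "\<lambda>s. min (w s) 0"] t by auto
  have "(INF s\<in>{0..t}. min (w s) 0) = min (w s) 0"
    using s by (intro cInf_eq_minimum) auto
  with s show thesis
    by (intro that[of s]) (auto simp: shortfall_def)
qed

lemma shortfall_ge:
  assumes "continuous_on {0..} w" "0 \<le> u" "u \<le> t"
  shows "- w u \<le> shortfall w t"
proof -
  obtain s :: real where "\<And>v. v \<in> {0..t} \<Longrightarrow> - min (w v) 0 \<le> shortfall w t"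
    using shortfall_attained[OF assms(1), of t] assms(2,3) by (metis order_trans)
  from this[of u] assms show ?thesis by (auto simp: min_def split: if_splits)
qed

lemma shortfall_nonneg:
  assumes "continuous_on {0..} w" "0 \<le> t"
  shows "0 \<le> shortfall w t"
  by (rule shortfall_attained[OF assms]) auto

lemma shortfall_mono:
  assumes "continuous_on {0..} w" "0 \<le> s" "s \<le> t"
  shows "shortfall w s \<le> shortfall w t"
proof -
  obtain u where u: "u \<in> {0..s}" "shortfall w s = - min (w u) 0"
    using shortfall_attained[OF assms(1,2)] by blast
  then show ?thesis
    using shortfall_ge[OF assms(1), of u t] shortfall_nonneg[OF assms(1), of t] assms by auto
qed

lemma shortfall_at_0: "shortfall w 0 = - min (w 0) 0"
  by (simp add: shortfall_def)

lemma reflected_nonneg: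
  assumes "continuous_on {0..} w" "0 \<le> t"
  shows "0 \<le> reflected w t"
  using shortfall_ge[OF assms order_refl] by (simp add: reflected_def)

text \<open>
  A path that is lower by at most \<open>c\<close> needs at most \<open>c\<close> more support; both Lipschitz bounds below
  follow by symmetry.
\<close>

lemma shortfall_le_add:
  assumes "continuous_on {0..} v" "continuous_on {0..} w" "0 \<le> t"
    and "\<And>s. s \<in> {0..t} \<Longrightarrow> w s \<le> v s + c" "0 \<le> c"
  shows "shortfall v t \<le> shortfall w t + c"
proof -
  obtain s where s: "s \<in> {0..t}" "shortfall v t = - min (v s) 0"
    using shortfall_attained[OF assms(1,3)] by blast
  then show ?thesis
    using shortfall_ge[OF assms(2), of s t] shortfall_nonneg[OF assms(2,3)] assms(4)[of s] assms(5)
    by (auto simp: min_def)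
qed

lemma shortfall_lipschitz:
  assumes v: "continuous_on {0..} v" and w: "continuous_on {0..} w" and t: "0 \<le> t"
    and c: "\<And>s. s \<in> {0..t} \<Longrightarrow> \<bar>v s - w s\<bar> \<le> c"
  shows "\<bar>shortfall v t - shortfall w t\<bar> \<le> c"
proof -
  have "0 \<le> c" using c[of 0] t by auto
  moreover have "w s \<le> v s + c" "v s \<le> w s + c" if "s \<in> {0..t}" for s
    using c[OF that] by auto
  ultimately show ?thesis
    using shortfall_le_add[OF v w t, of c] shortfall_le_add[OF w v t, of c] by auto
qed

lemma reflected_lipschitz:
  assumes "continuous_on {0..} v" "continuous_on {0..} w" "0 \<le> t"
    and "\<And>s. s \<in> {0..t} \<Longrightarrow> \<bar>v s - w s\<bar> \<le> c"
  shows "\<bar>reflected v t - reflected w t\<bar> \<le> 2 * c"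
  using shortfall_lipschitz[OF assms] assms(4)[of t] assms(3)
  unfolding reflected_def by auto

text \<open>
  Moving the dependence on \<open>t\<close> from the index set to the path reduces continuity in \<open>t\<close> to the
  Lipschitz bound, and makes a single countable dense set of indices suffice for all \<open>t\<close>.
\<close>

lemma shortfall_rescale:
  assumes "0 \<le> t"
  shows "shortfall w t = shortfall (\<lambda>r. w (t * r)) 1"
proof -
  have "{0..t} = (\<lambda>r. t * r) ` {0..1}"
    using assms by (simp add: image_mult_atLeastAtMost_if)
  then show ?thesis
    unfolding shortfall_def by (simp add: image_image)
qed

lemma continuous_on_rescale:
  assumes "continuous_on {0..} (w::real \<Rightarrow> real)" "0 \<le> t"
  shows "continuous_on {0..} (\<lambda>r. w (t * r))"
  using assms by (intro continuous_on_compose2[OF assms(1)] continuous_intros) auto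

lemma continuous_on_shortfall:
  assumes w: "continuous_on {0..} w"
  shows "continuous_on {0..} (shortfall w)"
  unfolding continuous_on_iff
proof (intro ballI allI impI)
  fix t0 \<epsilon> :: real assume t0: "t0 \<in> {0..}" and \<epsilon>: "0 < \<epsilon>"
  have "uniformly_continuous_on {0..t0 + 1} w"
    by (intro compact_uniformly_continuous continuous_on_subset[OF w]) auto
  then obtain \<delta> where \<delta>: "0 < \<delta>"
    "\<And>a b. a \<in> {0..t0 + 1} \<Longrightarrow> b \<in> {0..t0 + 1} \<Longrightarrow> dist b a < \<delta> \<Longrightarrow> dist (w b) (w a) < \<epsilon> / 2"
    unfolding uniformly_continuous_on_def using \<epsilon> half_gt_zero by meson
  show "\<exists>d>0. \<forall>t\<in>{0..}. dist t t0 < d \<longrightarrow> dist (shortfall w t) (shortfall w t0) < \<epsilon>"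
  proof (intro exI[of _ "min \<delta> 1"] conjI ballI impI)
    fix t assume t: "t \<in> {0..}" "dist t t0 < min \<delta> 1"
    have "\<bar>shortfall (\<lambda>r. w (t * r)) 1 - shortfall (\<lambda>r. w (t0 * r)) 1\<bar> \<le> \<epsilon> / 2"
    proof (intro shortfall_lipschitz continuous_on_rescale w)
      fix r :: real assume r: "r \<in> {0..1}"
      have "\<bar>t * r - t0 * r\<bar> \<le> \<bar>t - t0\<bar>"
        using r by (simp add: abs_mult mult_left_le flip: left_diff_distrib)
      moreover have "t * r \<le> t" "t0 * r \<le> t0" using r t t0 by (auto simp: mult_left_le)
      ultimately show "\<bar>w (t * r) - w (t0 * r)\<bar> \<le> \<epsilon> / 2"
        using \<delta>(2)[of "t0 * r" "t * r"] t r t0 by (auto simp: dist_real_def less_imp_le)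
    qed (use t t0 in auto)
    then show "dist (shortfall w t) (shortfall w t0) < \<epsilon>"
      using t t0 \<epsilon> by (simp add: dist_real_def shortfall_rescale[of _ w])
  qed (use \<delta> in auto)
qed

text \<open>
  The complementarity half of the Skorokhod problem: support is added only while the reflected path
  is at \<open>0\<close>, since a new record of \<open>- w\<close> is reached exactly there.
\<close>

lemma shortfall_flat:
  assumes w: "continuous_on {0..} w" and "0 \<le> s" "s \<le> t"
    and pos: "\<And>u. s < u \<Longrightarrow> u \<le> t \<Longrightarrow> 0 < reflected w u"
  shows "shortfall w t = shortfall w s"
proof (rule ccontr)
  assume "shortfall w t \<noteq> shortfall w s"
  then have less: "shortfall w s < shortfall w t"
    using shortfall_mono[OF assms(1-3)] by simp
  obtain u where u: "u \<in> {0..t}" "shortfall w t = - min (w u) 0"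
    using shortfall_attained[OF w, of t] assms(2,3) by (metis order_trans)
  have wu: "shortfall w t = - w u"
    using u less shortfall_nonneg[OF assms(1,2)] by (auto simp: min_def split: if_splits)
  with less have "s < u" using shortfall_ge[OF w, of u s] u by force
  moreover have "shortfall w u \<le> - w u"
    using shortfall_mono[OF w, of u t] u wu by auto
  ultimately show False using pos[of u] u by (auto simp: reflected_def)
qed

lemma INF_unit_interval_rational:
  fixes g :: "real \<Rightarrow> real"
  assumes g: "continuous_on {0..1} g"
  shows "(INF r\<in>{0..1}. g r) = (INF r\<in>{0..1} \<inter> \<rat>. g r)"
proof (rule antisym)
  have ne: "{0..1} \<inter> \<rat> \<noteq> ({}::real set)" by (auto simp: set_eq_iff intro!: exI[of _ 0])
  have "bdd_below (g ` {0..1})"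
    by (intro bounded_imp_bdd_below compact_imp_bounded compact_continuous_image g) auto
  then have bdd: "bdd_below (g ` ({0..1} \<inter> \<rat>))" by (rule bdd_below_mono) auto
  show "(INF r\<in>{0..1}. g r) \<le> (INF r\<in>{0..1} \<inter> \<rat>. g r)"
    using ne \<open>bdd_below (g ` {0..1})\<close> by (intro cINF_superset_mono) auto
  show "(INF r\<in>{0..1} \<inter> \<rat>. g r) \<le> (INF r\<in>{0..1}. g r)"
  proof (rule cINF_greatest)
    fix r :: real assume r: "r \<in> {0..1}"
    \<comment> \<open>rational approximation from below, which stays in the unit interval\<close>
    define x where "x = (\<lambda>n. of_int \<lfloor>real (Suc n) * r\<rfloor> / real (Suc n))"
    have bounds: "x n \<le> r" "r - inverse (real (Suc n)) \<le> x n" "0 \<le> x n" "x n \<in> \<rat>" for n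
    proof -
      have "real_of_int \<lfloor>real (Suc n) * r\<rfloor> \<le> real (Suc n) * r"
        by (rule of_int_floor_le)
      then show "x n \<le> r" unfolding x_def by (subst pos_divide_le_eq) (auto simp: mult.commute)
      have "real (Suc n) * r - 1 \<le> real_of_int \<lfloor>real (Suc n) * r\<rfloor>" by linarith
      then have "(real (Suc n) * r - 1) / real (Suc n) \<le> x n"
        unfolding x_def by (intro divide_right_mono) auto
      moreover have "(real (Suc n) * r - 1) / real (Suc n) = r - inverse (real (Suc n))"
        by (simp add: field_simps del: of_nat_Suc)
      ultimately show "r - inverse (real (Suc n)) \<le> x n" by simp
      show "0 \<le> x n" unfolding x_def using r by auto
      show "x n \<in> \<rat>" unfolding x_def by (intro Rats_divide) auto
    qed
    have "x \<longlonglongrightarrow> r"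
    proof (rule tendsto_sandwich[OF _ _ _ tendsto_const])
      show "(\<lambda>n. r - inverse (real (Suc n))) \<longlonglongrightarrow> r"
        using tendsto_diff[OF tendsto_const LIMSEQ_inverse_real_of_nat, of r] by simp
    qed (use bounds in auto)
    moreover have in01: "x n \<in> {0..1} \<inter> \<rat>" for n
      using bounds[of n] r by auto
    ultimately have "(\<lambda>n. g (x n)) \<longlonglongrightarrow> g r"
      using r g by (intro continuous_on_tendsto_compose[OF g]) auto
    then show "(INF r\<in>{0..1} \<inter> \<rat>. g r) \<le> g r"
      by (rule LIMSEQ_le_const) (use in01 bdd in \<open>auto intro!: cINF_lower\<close>)
  qed simp
qed

text \<open>
  Exhibits the shortfall as a countable infimum, from which it inherits measurability.
\<close>

lemma shortfall_countable:
  assumes w: "continuous_on {0..} w" and t: "0 \<le> t"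
  shows "shortfall w t = - (INF r\<in>{0..1} \<inter> \<rat>. min (w (t * r)) 0)"
proof -
  have "continuous_on {0..1} (\<lambda>r. min (w (t * r)) 0)"
    by (intro continuous_intros continuous_on_subset[OF continuous_on_rescale[OF w t]]) auto
  from INF_unit_interval_rational[OF this] show ?thesis
    unfolding shortfall_rescale[OF t] by (simp add: shortfall_def)
qed

section \<open>Payment rates capped by a function of the reflected path\<close>

abbreviation locally_integrable :: "(real \<Rightarrow> real) \<Rightarrow> bool" where
  "locally_integrable p \<equiv> (\<forall>t\<ge>0. set_integrable lborel {0..t} p)"

definition net_path :: "(real \<Rightarrow> real) \<Rightarrow> (real \<Rightarrow> real) \<Rightarrow> real \<Rightarrow> real" where
  "net_path z p t = z t - (LBINT s:{0..t}. p s)"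

lemma net_path_at_0: "net_path z p 0 = z 0"
proof -
  have "(\<lambda>s. indicator {0..0} s *\<^sub>R p s) = (\<lambda>s. p 0 * indicator {0} s)"
    by (auto simp: indicator_def)
  then show ?thesis by (simp add: net_path_def set_lebesgue_integral_def del: real_scaleR_def)
qed

lemma continuous_on_LBINT:
  assumes p: "locally_integrable p"
  shows "continuous_on {0..} (\<lambda>t. LBINT s:{0..t}. p s)"
  unfolding continuous_on_eq_continuous_within
proof
  fix t :: real assume t: "t \<in> {0..}"
  have int: "p integrable_on {0..t + 1}"
    using p t by (intro set_borel_integral_eq_integral) auto
  have "continuous_on {0..t + 1} (\<lambda>t. LBINT s:{0..t}. p s)"
    by (rule continuous_on_eq[OF indefinite_integral_continuous_1[OF int]])
       (use p in \<open>auto simp: set_borel_integral_eq_integral\<close>)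
  then have "continuous (at t within {0..t + 1}) (\<lambda>t. LBINT s:{0..t}. p s)"
    using t by (auto simp: continuous_on_eq_continuous_within)
  moreover have "at t within {0..t + 1} = at t within {0..}"
    by (rule at_within_nhd[of t "{..<t + 1}"]) auto
  ultimately show "continuous (at t within {0..}) (\<lambda>t. LBINT s:{0..t}. p s)"
    by simp
qed

lemma continuous_on_net_path:
  assumes "continuous_on {0..} z" "locally_integrable p"
  shows "continuous_on {0..} (net_path z p)"
  unfolding net_path_def by (intro continuous_intros assms continuous_on_LBINT)

lemma set_integrable_mono_bound:
  fixes f g :: "real \<Rightarrow> real"
  assumes "set_integrable lborel A f" "set_borel_measurable lborel A g"
    and "\<And>x. x \<in> A \<Longrightarrow> \<bar>g x\<bar> \<le> f x"
  shows "set_integrable lborel A g"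
  using assms(1,2) unfolding set_integrable_def set_borel_measurable_def
  by (rule Bochner_Integration.integrable_bound)
     (use assms(3) order_trans[OF _ abs_ge_self] in \<open>auto simp: indicator_def\<close>)

lemma LBINT_nonneg_on:
  fixes f :: "real \<Rightarrow> real"
  assumes "\<And>x. x \<in> A \<Longrightarrow> 0 \<le> f x"
  shows "0 \<le> (LBINT x:A. f x)"
  unfolding set_lebesgue_integral_def
  by (intro integral_nonneg_AE AE_I2) (use assms in \<open>auto simp: indicator_def\<close>)

lemma LBINT_mono_interval:
  fixes f :: "real \<Rightarrow> real"
  assumes "locally_integrable f" "\<And>u. 0 \<le> u \<Longrightarrow> 0 \<le> f u" "0 \<le> s" "s \<le> t"
  shows "(LBINT u:{0..s}. f u) \<le> (LBINT u:{0..t}. f u)"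
  unfolding set_lebesgue_integral_def
  by (intro integral_mono)
     (use assms in \<open>auto simp: indicator_def set_integrable_def\<close>)

text \<open>
  The distance of the accumulated payments controls the distance of the two paths uniformly up to
  \<open>t\<close>, which is the form that the Lipschitz bound of reflection needs.
\<close>

lemma abs_net_path_diff_le:
  assumes p: "locally_integrable p" and p': "locally_integrable p'" and s: "0 \<le> s" "s \<le> t"
  shows "\<bar>net_path z p s - net_path z p' s\<bar> \<le> (LBINT u:{0..t}. \<bar>p u - p' u\<bar>)"
proof -
  have d: "locally_integrable (\<lambda>u. p u - p' u)"
    using p p' by auto
  have "net_path z p s - net_path z p' s = - (LBINT u:{0..s}. p u - p' u)"
    using p p' s by (simp add: net_path_def)
  then have "\<bar>net_path z p s - net_path z p' s\<bar> \<le> (LBINT u:{0..s}. \<bar>p u - p' u\<bar>)"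
    using set_integral_norm_bound[of lborel "{0..s}" "\<lambda>u. p u - p' u"] d s by simp
  also have "\<dots> \<le> (LBINT u:{0..t}. \<bar>p u - p' u\<bar>)"
    using d s by (intro LBINT_mono_interval) (auto intro: set_integrable_abs)
  finally show ?thesis .
qed

text \<open>
  Picard iterates for the equation \<open>p t = min (a t) (f (reflected (net_path z p) t))\<close>.
\<close>

primrec capped_iteration ::
    "(real \<Rightarrow> real) \<Rightarrow> (real \<Rightarrow> real) \<Rightarrow> (real \<Rightarrow> real) \<Rightarrow> nat \<Rightarrow> real \<Rightarrow> real" where
  "capped_iteration f z a 0 = (\<lambda>_. 0)"
| "capped_iteration f z a (Suc n) =
     (\<lambda>t. min (a t) (f (reflected (net_path z (capped_iteration f z a n)) t)))"

text \<open>
  The solution is defined as a pointwise limit, so that measurability in time and scenario passes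
  from the iterates to it.
\<close>

definition capped_rate ::
    "(real \<Rightarrow> real) \<Rightarrow> (real \<Rightarrow> real) \<Rightarrow> (real \<Rightarrow> real) \<Rightarrow> real \<Rightarrow> real" where
  "capped_rate f z a t = lim (\<lambda>n. capped_iteration f z a n t)"

declare capped_iteration.simps [simp del]

locale capped_reflection =
  fixes f :: "real \<Rightarrow> real" and K :: real and z a :: "real \<Rightarrow> real"
  assumes K_pos: "0 < K"
    and f_lipschitz: "\<And>x y. \<bar>f x - f y\<bar> \<le> K * \<bar>x - y\<bar>"
    and f_nonneg: "\<And>x. 0 \<le> f x"
    and z_cont: "continuous_on {0..} z"
    and a_nonneg: "\<And>t. 0 \<le> t \<Longrightarrow> 0 \<le> a t"
    and a_int: "locally_integrable a"
begin

abbreviation step :: "(real \<Rightarrow> real) \<Rightarrow> real \<Rightarrow> real" where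
  "step p t \<equiv> min (a t) (f (reflected (net_path z p) t))"

abbreviation iter :: "nat \<Rightarrow> real \<Rightarrow> real" where
  "iter \<equiv> capped_iteration f z a"

lemma f_cont: "continuous_on UNIV f"
  by (rule lipschitz_on_continuous_on[of K])
     (auto intro!: lipschitz_onI simp: dist_real_def f_lipschitz K_pos less_imp_le)

lemma reflected_net_path_cont:
  assumes "locally_integrable p"
  shows "continuous_on {0..} (reflected (net_path z p))"
  unfolding reflected_def
  by (intro continuous_intros continuous_on_shortfall continuous_on_net_path z_cont assms)

lemma step_integrable:
  assumes p: "locally_integrable p"
  shows "locally_integrable (step p)"
proof (intro allI impI)
  fix t :: real assume t: "0 \<le> t"
  have 1: "set_borel_measurable lborel {0..t} a"
    using a_int t by (auto simp: set_integrable_def set_borel_measurable_def)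
  have "continuous_on {0..t} (\<lambda>s. f (reflected (net_path z p) s))"
    by (rule continuous_on_compose2[OF f_cont continuous_on_subset[OF reflected_net_path_cont[OF p]]]) auto
  then have 2: "set_borel_measurable lborel {0..t} (\<lambda>s. f (reflected (net_path z p) s))"
    unfolding set_borel_measurable_def
    using borel_measurable_continuous_on_indicator[of "{0..t}"] by (simp del: real_scaleR_def)
  have "set_borel_measurable lborel {0..t} (step p)"
  proof -
    have "(\<lambda>s. indicator {0..t} s *\<^sub>R step p s) =
      (\<lambda>s. min (indicator {0..t} s *\<^sub>R a s) (indicator {0..t} s *\<^sub>R f (reflected (net_path z p) s)))"
      by (auto simp: indicator_def)
    then show ?thesis
      using 1 2 unfolding set_borel_measurable_def by (simp del: real_scaleR_def)
  qed
  then show "set_integrable lborel {0..t} (step p)"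
    using a_int t by - (rule set_integrable_mono_bound[of _ a], simp_all add: a_nonneg f_nonneg)
qed

lemma iter_Suc: "iter (Suc n) t = step (iter n) t"
  by (simp add: capped_iteration.simps)

lemma iter_integrable: "locally_integrable (iter n)"
proof (induction n)
  case 0
  then show ?case by (simp add: capped_iteration.simps set_integrable_def)
next
  case (Suc n)
  from step_integrable[OF this] show ?case by (simp only: capped_iteration.simps)
qed

lemma iter_bounds: "0 \<le> t \<Longrightarrow> 0 \<le> iter n t \<and> iter n t \<le> a t"
  by (cases n) (auto simp: capped_iteration.simps a_nonneg f_nonneg)

text \<open>
  One Picard step is a Volterra operator with constant \<open>2 * K\<close>: reflection doubles the uniform
  distance of paths, \<open>f\<close> multiplies it by \<open>K\<close>, and capping does not increase it.
\<close>

lemma step_diff_le: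
  assumes p: "locally_integrable p" and p': "locally_integrable p'" and t: "0 \<le> t"
  shows "\<bar>step p t - step p' t\<bar> \<le> 2 * K * (LBINT u:{0..t}. \<bar>p u - p' u\<bar>)"
proof -
  let ?x = "reflected (net_path z p) t" and ?x' = "reflected (net_path z p') t"
  have "\<bar>step p t - step p' t\<bar> \<le> \<bar>f ?x - f ?x'\<bar>"
    by (auto simp: min_def)
  also have "\<dots> \<le> K * \<bar>?x - ?x'\<bar>"
    by (rule f_lipschitz)
  also have "\<bar>?x - ?x'\<bar> \<le> 2 * (LBINT u:{0..t}. \<bar>p u - p' u\<bar>)"
    using t abs_net_path_diff_le[OF p p']
    by (intro reflected_lipschitz continuous_on_net_path z_cont p p') auto
  finally show ?thesis using K_pos by (simp add: mult_left_mono)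
qed

lemma LBINT_exp_le:
  fixes t c :: real
  assumes "0 \<le> t" "0 < c"
  shows "set_integrable lborel {0..t} (\<lambda>s. exp (c * s))" (is ?I)
    and "(LBINT s:{0..t}. exp (c * s)) \<le> exp (c * t) / c"
proof -
  show ?I
    by (rule borel_integrable_atLeastAtMost') (intro continuous_intros)
  have "((\<lambda>s. exp (c * s)) has_integral (exp (c * t) / c - exp (c * 0) / c)) {0..t}"
    using assms by (intro fundamental_theorem_of_calculus)
      (auto intro!: derivative_eq_intros simp flip: has_real_derivative_iff_has_vector_derivative)
  then have "integral {0..t} (\<lambda>s. exp (c * s)) = exp (c * t) / c - 1 / c"
    by (simp add: integral_unique)
  then show "(LBINT s:{0..t}. exp (c * s)) \<le> exp (c * t) / c"
    using \<open>?I\<close> assms by (simp add: set_borel_integral_eq_integral)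
qed

text \<open>
  With the weight \<open>exp (4 * K * t)\<close> the Volterra constant \<open>2 * K\<close> becomes a contraction factor
  \<open>1 / 2\<close>, on every bounded time interval. The first increment is bounded by \<open>C\<close> and starts the
  induction.
\<close>

lemma iter_diff_le:
  assumes T: "0 \<le> T"
  defines "C \<equiv> 2 * K * (LBINT u:{0..T}. \<bar>iter (Suc 0) u - iter 0 u\<bar>)"
  assumes t: "0 \<le> t" "t \<le> T"
  shows "\<bar>iter (Suc (Suc n)) t - iter (Suc n) t\<bar> \<le> C * exp (4 * K * t) / 2 ^ n"
  using t
proof (induction n arbitrary: t)
  case 0
  have C0: "0 \<le> C" unfolding C_def using K_pos by (intro mult_nonneg_nonneg LBINT_nonneg_on) auto
  have "\<bar>step (iter (Suc 0)) t - step (iter 0) t\<bar> \<le> 2 * K * (LBINT u:{0..t}. \<bar>iter (Suc 0) u - iter 0 u\<bar>)"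
    using 0 by (intro step_diff_le iter_integrable)
  also have "\<dots> \<le> C"
    unfolding C_def using K_pos 0 iter_integrable[of 0] iter_integrable[of "Suc 0"]
    by (intro mult_left_mono LBINT_mono_interval) (auto intro!: set_integrable_abs set_integral_diff(1))
  also have "\<dots> \<le> C * exp (4 * K * t)"
    using C0 K_pos 0 by (simp add: mult_le_cancel_left1)
  finally show ?case by (simp add: iter_Suc)
next
  case (Suc n)
  let ?d = "\<lambda>u. \<bar>iter (Suc (Suc n)) u - iter (Suc n) u\<bar>"
  have d: "set_integrable lborel {0..t} ?d"
    using Suc.prems iter_integrable by (intro set_integrable_abs set_integral_diff) (auto)
  have "\<bar>step (iter (Suc (Suc n))) t - step (iter (Suc n)) t\<bar> \<le> 2 * K * (LBINT u:{0..t}. ?d u)"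
    using Suc.prems by (intro step_diff_le iter_integrable)
  also have "(LBINT u:{0..t}. ?d u) \<le> (LBINT u:{0..t}. (C / 2 ^ n) * exp (4 * K * u))"
    using Suc LBINT_exp_le(1)[of t "4 * K"] K_pos d
    by (intro set_integral_mono) (auto)
  also have "\<dots> = C / 2 ^ n * (LBINT u:{0..t}. exp (4 * K * u))"
    by (rule set_integral_mult_right)
  also have "\<dots> \<le> C / 2 ^ n * (exp (4 * K * t) / (4 * K))"
    using LBINT_exp_le(2)[of t "4 * K"] K_pos Suc.prems
    by (intro mult_left_mono) (auto simp: C_def intro!: divide_nonneg_pos mult_nonneg_nonneg LBINT_nonneg_on)
  finally have "\<bar>step (iter (Suc (Suc n))) t - step (iter (Suc n)) t\<bar> \<le>
      2 * K * (C / 2 ^ n * (exp (4 * K * t) / (4 * K)))"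
    using K_pos by (simp add: mult_left_mono)
  also have "\<dots> = C * exp (4 * K * t) / 2 ^ Suc n"
    using K_pos by (simp add: field_simps)
  finally show ?case by (simp only: iter_Suc[of "Suc (Suc n)"] iter_Suc[of "Suc n" t])
qed

lemma iter_convergent:
  assumes t: "0 \<le> t"
  shows "convergent (\<lambda>n. iter n t)"
proof -
  define C where "C = 2 * K * (LBINT u:{0..t}. \<bar>iter (Suc 0) u - iter 0 u\<bar>) * exp (4 * K * t)"
  have "summable (\<lambda>n. iter (Suc (Suc n)) t - iter (Suc n) t)"
  proof (rule summable_comparison_test')
    show "summable (\<lambda>n. C * (1 / 2) ^ n)" by (intro summable_mult summable_geometric) auto
    show "norm (iter (Suc (Suc n)) t - iter (Suc n) t) \<le> C * (1 / 2) ^ n" for n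
      using iter_diff_le[OF t t order_refl, of n]
      by (simp add: C_def power_one_over)
  qed
  then have "convergent (\<lambda>n. \<Sum>k<n. iter (Suc (Suc k)) t - iter (Suc k) t)"
    by (simp add: summable_iff_convergent)
  then have "convergent (\<lambda>n. iter (Suc n) t - iter (Suc 0) t)"
    by (simp add: sum_lessThan_telescope[of "\<lambda>k. iter (Suc k) t"])
  then have "convergent (\<lambda>n. iter (Suc n) t)"
    using convergent_add[OF _ convergent_const[of "iter (Suc 0) t"]] by fastforce
  then show ?thesis by (subst (asm) convergent_Suc_iff)
qed

lemma iter_LIMSEQ: "0 \<le> t \<Longrightarrow> (\<lambda>n. iter n t) \<longlonglongrightarrow> capped_rate f z a t"
  using iter_convergent[of t] by (simp add: capped_rate_def convergent_LIMSEQ_iff)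

lemma capped_rate_bounds:
  assumes t: "0 \<le> t"
  shows "0 \<le> capped_rate f z a t" "capped_rate f z a t \<le> a t"
  using LIMSEQ_le_const[OF iter_LIMSEQ[OF t], of 0] LIMSEQ_le_const2[OF iter_LIMSEQ[OF t], of "a t"]
    iter_bounds[OF t] by auto

lemma capped_rate_integrable: "locally_integrable (capped_rate f z a)"
proof (intro allI impI)
  fix t :: real assume t: "0 \<le> t"
  have "set_borel_measurable lborel {0..t} (capped_rate f z a)"
    unfolding set_borel_measurable_def
  proof (rule borel_measurable_LIMSEQ_real)
    show "(\<lambda>n. indicator {0..t} s *\<^sub>R iter n s) \<longlonglongrightarrow> indicator {0..t} s *\<^sub>R capped_rate f z a s" for s
      using iter_LIMSEQ[of s] by (auto simp: indicator_def)
    show "(\<lambda>s. indicator {0..t} s *\<^sub>R iter n s) \<in> borel_measurable lborel" for n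
      using iter_integrable[of n] t by (auto simp: set_integrable_def)
  qed
  then show "set_integrable lborel {0..t} (capped_rate f z a)"
    using a_int t by - (rule set_integrable_mono_bound[of _ a], simp_all add: capped_rate_bounds)
qed

lemma iter_L1_convergence:
  assumes t: "0 \<le> t"
  shows "(\<lambda>n. LBINT u:{0..t}. \<bar>iter n u - capped_rate f z a u\<bar>) \<longlonglongrightarrow> 0"
proof -
  have "(\<lambda>n. \<integral>u. indicator {0..t} u *\<^sub>R \<bar>iter n u - capped_rate f z a u\<bar> \<partial>lborel) \<longlonglongrightarrow>
      (\<integral>u. 0 \<partial>(lborel :: real measure))"
  proof (rule integral_dominated_convergence[where w = "\<lambda>u. indicator {0..t} u *\<^sub>R a u"])
    have "set_integrable lborel {0..t} (\<lambda>u. \<bar>iter n u - capped_rate f z a u\<bar>)" for n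
      using t iter_integrable capped_rate_integrable
      by (intro set_integrable_abs set_integral_diff) auto
    then show "(\<lambda>u. indicator {0..t} u *\<^sub>R \<bar>iter n u - capped_rate f z a u\<bar>) \<in> borel_measurable lborel" for n
      by (auto simp: set_integrable_def)
    show "integrable lborel (\<lambda>u. indicator {0..t} u *\<^sub>R a u)"
      using a_int t by (auto simp: set_integrable_def)
    show "AE u in lborel. (\<lambda>n. indicator {0..t} u *\<^sub>R \<bar>iter n u - capped_rate f z a u\<bar>) \<longlonglongrightarrow> 0"
    proof (rule AE_I2)
      fix u :: real
      show "(\<lambda>n. indicator {0..t} u *\<^sub>R \<bar>iter n u - capped_rate f z a u\<bar>) \<longlonglongrightarrow> 0"
        using tendsto_rabs_zero[OF LIM_zero[OF iter_LIMSEQ[of u]]] by (auto simp: indicator_def)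
    qed
    show "AE u in lborel. norm (indicator {0..t} u *\<^sub>R \<bar>iter n u - capped_rate f z a u\<bar>) \<le>
        indicator {0..t} u *\<^sub>R a u" for n
    proof (rule AE_I2)
      fix u :: real
      show "norm (indicator {0..t} u *\<^sub>R \<bar>iter n u - capped_rate f z a u\<bar>) \<le> indicator {0..t} u *\<^sub>R a u"
        using iter_bounds[of u n] capped_rate_bounds[of u] by (cases "u \<in> {0..t}") auto
    qed
  qed auto
  then show ?thesis by (simp add: set_lebesgue_integral_def)
qed

text \<open>
  The iterates converge dominatedly, hence in mean on bounded intervals, and by
  \<open>step_diff_le\<close> their images under the Picard step converge to the image of the limit.
\<close>

theorem capped_rate_fixpoint:
  assumes t: "0 \<le> t"
  shows "capped_rate f z a t = min (a t) (f (reflected (net_path z (capped_rate f z a)) t))"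
proof -
  let ?p = "capped_rate f z a"
  have "(\<lambda>n. step (iter n) t - step ?p t) \<longlonglongrightarrow> 0"
  proof (rule Lim_null_comparison)
    show "(\<lambda>n. 2 * K * (LBINT u:{0..t}. \<bar>iter n u - ?p u\<bar>)) \<longlonglongrightarrow> 0"
      by (intro tendsto_mult_right_zero iter_L1_convergence t)
    show "\<forall>\<^sub>F n in sequentially. norm (step (iter n) t - step ?p t) \<le> 2 * K * (LBINT u:{0..t}. \<bar>iter n u - ?p u\<bar>)"
      unfolding real_norm_def by (intro always_eventually allI step_diff_le iter_integrable capped_rate_integrable t)
  qed
  then have "(\<lambda>n. iter (Suc n) t) \<longlonglongrightarrow> step ?p t"
    unfolding iter_Suc by (rule LIM_zero_cancel)
  with LIMSEQ_Suc[OF iter_LIMSEQ[OF t]] show ?thesis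
    by (rule LIMSEQ_unique)
qed

end

section \<open>Comparison with an arbitrary controlled path\<close>

text \<open>
  Suppose the difference \<open>c + G\<close> of the two states is negative at \<open>t\<close>, and let \<open>s\<close> be the last time
  before \<open>t\<close> at which it is nonnegative; it is nonnegative at \<open>s\<close> itself because \<open>c\<close> is continuous
  and \<open>G\<close> only jumps up. After \<open>s\<close> the reflected state is larger, so the cap
  given by \<open>f\<close> does not bind and both strategies pay \<open>l\<close>, while the reflected state is positive and
  receives nothing. The difference then grows by the increment of \<open>G\<close>, a contradiction.
\<close>

lemma (in capped_reflection) reflected_le_controlled:
  fixes l G :: "real \<Rightarrow> real" and T :: ennreal
  defines "p \<equiv> capped_rate f z a"
  assumes f_mono: "mono f" and z0: "0 \<le> z 0"
    and l_int: "locally_integrable l" and G: "mono G" "0 \<le> G 0"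
    and a_eq: "\<And>t. 0 \<le> t \<Longrightarrow> ennreal t \<le> T \<Longrightarrow> a t = l t"
    and X_nonneg: "\<And>t. 0 \<le> t \<Longrightarrow> ennreal t \<le> T \<Longrightarrow> 0 \<le> net_path z l t + G t"
    and l_le: "\<And>t. 0 \<le> t \<Longrightarrow> ennreal t \<le> T \<Longrightarrow> l t \<le> f (net_path z l t + G t)"
    and t: "0 \<le> t" "ennreal t \<le> T"
  shows "reflected (net_path z p) t \<le> net_path z l t + G t"
proof (rule ccontr)
  assume neg: "\<not> reflected (net_path z p) t \<le> net_path z l t + G t"
  define c where "c u = net_path z l u - reflected (net_path z p) u" for u
  define S where "S = {u \<in> {0..t}. 0 \<le> c u + G u}"
  define s where "s = Sup S"
  have p_int: "locally_integrable p"
    unfolding p_def by (rule capped_rate_integrable)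
  have c_cont: "continuous_on {0..} c"
    unfolding c_def
    by (intro continuous_intros reflected_net_path_cont continuous_on_net_path z_cont p_int l_int)
  have "c 0 = 0"
    using z0 by (simp add: c_def reflected_def shortfall_at_0 net_path_at_0)
  then have S0: "0 \<in> S"
    using t G by (simp add: S_def)
  have S_sub: "S \<subseteq> {0..t}" by (auto simp: S_def)
  then have bdd: "bdd_above S" by (meson bdd_above_Icc bdd_above_mono)
  have clS: "closure S \<subseteq> {0..t}" using S_sub by (intro closure_minimal) auto
  have s_cl: "s \<in> closure S"
    unfolding s_def using S0 bdd by (intro closure_contains_Sup) auto
  with clS have s: "0 \<le> s" "s \<le> t" by auto
  \<comment> \<open>on \<open>S\<close> the value \<open>G s\<close> dominates \<open>G u\<close>, and with \<open>G s\<close> frozen the difference is continuous\<close>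
  have "0 \<le> c s + G s"
  proof (rule continuous_ge_on_closure[where f = "\<lambda>u. c u + G s", OF _ s_cl])
    show "continuous_on (closure S) (\<lambda>u. c u + G s)"
      using clS by (intro continuous_intros continuous_on_subset[OF c_cont]) auto
    fix u assume u: "u \<in> S"
    then have "G u \<le> G s"
      using bdd by (intro monoD[OF G(1)]) (auto simp: s_def intro: cSup_upper)
    then show "0 \<le> c u + G s" using u by (simp add: S_def)
  qed
  moreover have below: "c u + G u < 0" if "s < u" "u \<le> t" for u
  proof (rule ccontr)
    assume "\<not> c u + G u < 0"
    then have "u \<in> S" using that s by (auto simp: S_def)
    then show False using cSup_upper[OF _ bdd, of u] that by (simp add: s_def)
  qed
  have le_T: "ennreal u \<le> T" if "u \<le> t" for u
    using that t by (meson ennreal_leI order_trans)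
  have above: "net_path z l u + G u < reflected (net_path z p) u" if "s < u" "u \<le> t" for u
    using below[OF that] by (simp add: c_def)
  have p_eq: "p u = l u" if u: "s < u" "u \<le> t" for u
  proof -
    have "l u \<le> f (net_path z l u + G u)"
      using u s le_T by (intro l_le) auto
    also have "\<dots> \<le> f (reflected (net_path z p) u)"
      using above[OF u] by (intro monoD[OF f_mono]) auto
    finally show ?thesis
      using capped_rate_fixpoint[of u] a_eq[of u] u s le_T[of u] by (simp add: p_def)
  qed
  have "shortfall (net_path z p) t = shortfall (net_path z p) s"
  proof (rule shortfall_flat[OF _ s])
    show "continuous_on {0..} (net_path z p)"
      by (intro continuous_on_net_path z_cont p_int)
    show "0 < reflected (net_path z p) u" if "s < u" "u \<le> t" for u
      using above[OF that] X_nonneg[of u] that s le_T[of u] by auto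
  qed
  moreover have "(LBINT u:{0..t}. l u - p u) = (LBINT u:{0..s}. l u - p u)"
    unfolding set_lebesgue_integral_def
    by (intro Bochner_Integration.integral_cong) (use p_eq s in \<open>auto simp: indicator_def\<close>)
  then have "(LBINT u:{0..t}. l u) - (LBINT u:{0..t}. p u) = (LBINT u:{0..s}. l u) - (LBINT u:{0..s}. p u)"
    using l_int p_int s t by simp
  moreover have "G s \<le> G t" using s by (intro monoD[OF G(1)])
  ultimately show False
    using neg by (simp add: c_def reflected_def net_path_def)
qed

section \<open>Stopped clocks\<close>

text \<open>
  Real-valued even for \<open>T = \<infinity>\<close>, because a clock that runs from \<open>0\<close> to \<open>s\<close> shows a finite time.
\<close>

definition stopped :: "ennreal \<Rightarrow> real \<Rightarrow> real" where
  "stopped T s = enn2real (min (ennreal s) T)"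

lemma stopped_nonneg: "0 \<le> stopped T s"
  by (simp add: stopped_def)

lemma stopped_mono: "s \<le> t \<Longrightarrow> stopped T s \<le> stopped T t"
  unfolding stopped_def by (intro enn2real_mono min.mono ennreal_leI) (auto simp: min_less_iff_disj)

lemma ennreal_stopped: "ennreal (stopped T s) = min (ennreal s) T"
  unfolding stopped_def by (rule ennreal_enn2real) (auto simp: min_less_iff_disj)

lemma stopped_le: "0 \<le> s \<Longrightarrow> stopped T s \<le> s"
  using ennreal_stopped[of T s] by (metis ennreal_le_iff min.cobounded1)

lemma stopped_le_time: "ennreal (stopped T s) \<le> T"
  by (simp add: ennreal_stopped)

lemma stopped_before: "0 \<le> s \<Longrightarrow> ennreal s \<le> T \<Longrightarrow> stopped T s = s"
  by (simp add: stopped_def min_absorb1)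

lemma stopped_mono_time: "T \<le> T' \<Longrightarrow> stopped T s \<le> stopped T' s"
  unfolding stopped_def by (intro enn2real_mono min.mono) (auto simp: min_less_iff_disj)

lemma le_stopped_iff: "0 \<le> s \<Longrightarrow> 0 \<le> t \<Longrightarrow> t \<le> stopped T s \<longleftrightarrow> t \<le> s \<and> ennreal t \<le> T"
  using ennreal_stopped[of T s] stopped_nonneg[of T s] by (metis ennreal_le_iff min.bounded_iff)

lemma stopped_eq: "0 \<le> t \<Longrightarrow> stopped T t = (if T = \<infinity> then t else min t (enn2real T))"
  by (cases T) (auto simp: stopped_def min_def)

lemma continuous_on_stopped: "continuous_on {0..} (stopped T)"
proof -
  have "continuous_on {0..} (\<lambda>t. if T = \<infinity> then t else min t (enn2real T))"
    by (cases "T = \<infinity>") (simp_all add: continuous_on_id continuous_on_min continuous_on_const)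
  then show ?thesis
    by (rule continuous_on_eq) (simp add: stopped_eq)
qed

lemma stopped_after: "0 \<le> t \<Longrightarrow> \<not> ennreal t \<le> T \<Longrightarrow> stopped T t = enn2real T"
  by (cases T) (auto simp: stopped_def min_def)

section \<open>Adaptedness and progressive measurability\<close>

lemma measurable_filtration_mono:
  assumes "filtered_prob_space M \<FF>" "s \<le> t" "f \<in> borel_measurable (\<FF> s)"
  shows "f \<in> borel_measurable (\<FF> t)"
proof -
  have "subalgebra (\<FF> t) (\<FF> s)"
    using assms(1,2) unfolding filtered_prob_space_def subalgebra_def filtration_def by auto
  then show ?thesis
    using assms(3) by (rule measurable_from_subalg)
qed

lemma space_filtration: "filtered_prob_space M \<FF> \<Longrightarrow> space (\<FF> t) = space M"
  by (auto simp: filtered_prob_space_def subalgebra_def)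

lemma ceiling_grid_LIMSEQ:
  fixes s t :: real
  assumes "s \<in> {0..t}"
  shows "(\<lambda>n. min t (real (nat \<lceil>s * real (Suc n)\<rceil>) / real (Suc n))) \<longlonglongrightarrow> s"
proof (rule tendsto_sandwich[OF _ _ tendsto_const])
  show "(\<lambda>n. s + inverse (real (Suc n))) \<longlonglongrightarrow> s"
    using tendsto_add[OF tendsto_const LIMSEQ_inverse_real_of_nat, of s] by simp
  have *: "real (nat \<lceil>s * real (Suc n)\<rceil>) = of_int \<lceil>s * real (Suc n)\<rceil>" for n
  proof -
    have "0 \<le> s * real (Suc n)" using assms by auto
    then show ?thesis by linarith
  qed
  have "s \<le> real (nat \<lceil>s * real (Suc n)\<rceil>) / real (Suc n)" for n
    unfolding * by (subst pos_le_divide_eq) auto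
  then show "\<forall>\<^sub>F n in sequentially. s \<le> min t (real (nat \<lceil>s * real (Suc n)\<rceil>) / real (Suc n))"
    using assms by auto
  have "real (nat \<lceil>s * real (Suc n)\<rceil>) / real (Suc n) \<le> s + inverse (real (Suc n))" for n
  proof -
    have "real (nat \<lceil>s * real (Suc n)\<rceil>) \<le> s * real (Suc n) + 1"
      unfolding * by linarith
    also have "\<dots> = (s + inverse (real (Suc n))) * real (Suc n)"
      by (simp add: field_simps del: of_nat_Suc)
    finally show ?thesis by (subst pos_divide_le_eq) auto
  qed
  then show "\<forall>\<^sub>F n in sequentially.
      min t (real (nat \<lceil>s * real (Suc n)\<rceil>) / real (Suc n)) \<le> s + inverse (real (Suc n))"
    by (auto simp: min_le_iff_disj)
qed

text \<open>
  Evaluating the process at the next point of a grid that refines gives processes with countably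
  many time values that converge by continuity. The grid is cut off at \<open>t\<close>, so that only information
  available at \<open>t\<close> is used.
\<close>

lemma progressively_measurable_continuous:
  assumes filt: "filtered_prob_space M \<FF>" and Y: "adapted \<FF> Y"
    and cont: "\<And>\<omega>. \<omega> \<in> space M \<Longrightarrow> continuous_on {0..} (\<lambda>t. Y t \<omega>)"
  shows "progressively_measurable \<FF> Y"
  unfolding progressively_measurable_def
proof (intro allI impI)
  fix t :: real assume t: "0 \<le> t"
  let ?N = "restrict_space borel {0..t} \<Otimes>\<^sub>M \<FF> t"
  define x where "x n k = min t (real k / real (Suc n))" for n k :: nat
  define g where "g n s = nat \<lceil>s * real (Suc n)\<rceil>" for n and s :: real
  show "(\<lambda>(s, \<omega>). Y s \<omega>) \<in> borel_measurable ?N"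
  proof (rule borel_measurable_LIMSEQ_real)
    show "(\<lambda>n. Y (x n (g n (fst p))) (snd p)) \<longlonglongrightarrow> (case p of (s, \<omega>) \<Rightarrow> Y s \<omega>)"
      if "p \<in> space ?N" for p
    proof -
      have "p \<in> {0..t} \<times> space M"
        using that by (simp add: space_pair_measure space_restrict_space space_filtration[OF filt])
      then obtain s \<omega> where p: "p = (s, \<omega>)" "s \<in> {0..t}" "\<omega> \<in> space M"
        by blast
      have "(\<lambda>n. x n (g n s)) \<longlonglongrightarrow> s"
        using ceiling_grid_LIMSEQ[OF p(2)] by (simp add: x_def g_def)
      then show ?thesis
        using p t by (auto intro!: continuous_on_tendsto_compose[OF cont] simp: x_def)
    qed
    show "(\<lambda>p. Y (x n (g n (fst p))) (snd p)) \<in> borel_measurable ?N" for n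
    proof (rule measurable_compose_countable[where f = "\<lambda>k p. Y (x n k) (snd p)" and g = "\<lambda>p. g n (fst p)"])
      have "Y (x n k) \<in> borel_measurable (\<FF> t)" for k
        using Y t by (intro measurable_filtration_mono[OF filt, of "x n k" t]) (auto simp: adapted_def x_def)
      then show "(\<lambda>p. Y (x n k) (snd p)) \<in> borel_measurable ?N" for k
        by measurable
      have "(\<lambda>s. g n s) \<in> restrict_space borel {0..t} \<rightarrow>\<^sub>M count_space UNIV"
        unfolding g_def by (intro measurable_restrict_space1) measurable
      then show "(\<lambda>p. g n (fst p)) \<in> ?N \<rightarrow>\<^sub>M count_space UNIV"
        by measurable
    qed
  qed
qed

lemma adapted_LBINT:
  assumes "progressively_measurable \<FF> p"
  shows "adapted \<FF> (\<lambda>t \<omega>. LBINT s:{0..t}. p s \<omega>)"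
  unfolding adapted_def
proof (intro allI impI)
  fix t :: real assume t: "0 \<le> t"
  let ?L = "restrict_space lborel {0..t}"
  interpret L: sigma_finite_measure ?L
    by (rule sigma_finite_measure_restrict_space) (auto intro: lborel.sigma_finite_measure_axioms)
  have "(\<lambda>(s, \<omega>). p s \<omega>) \<in> borel_measurable (restrict_space borel {0..t} \<Otimes>\<^sub>M \<FF> t)"
    using assms t by (auto simp: progressively_measurable_def)
  also have "borel_measurable (restrict_space borel {0..t} \<Otimes>\<^sub>M \<FF> t) = borel_measurable (?L \<Otimes>\<^sub>M \<FF> t)"
    by (intro measurable_cong_sets sets_pair_measure_cong sets_restrict_space_cong) auto
  finally have "(\<lambda>(\<omega>, s). p s \<omega>) \<in> borel_measurable (\<FF> t \<Otimes>\<^sub>M ?L)"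
    by (subst measurable_pair_swap_iff) (simp add: case_prod_beta)
  then have "(\<lambda>\<omega>. \<integral>s. p s \<omega> \<partial>?L) \<in> borel_measurable (\<FF> t)"
    by (intro L.borel_measurable_lebesgue_integral) simp
  then show "(\<lambda>\<omega>. LBINT s:{0..t}. p s \<omega>) \<in> borel_measurable (\<FF> t)"
    by (simp add: integral_restrict_space set_lebesgue_integral_def)
qed

lemma progressively_measurable_section:
  assumes "filtered_prob_space M \<FF>" "progressively_measurable \<FF> p" "0 \<le> t" "\<omega> \<in> space M"
  shows "set_borel_measurable lborel {0..t} (\<lambda>s. p s \<omega>)"
proof -
  have "(\<lambda>(s, \<omega>). p s \<omega>) \<in> borel_measurable (restrict_space borel {0..t} \<Otimes>\<^sub>M \<FF> t)"
    using assms by (auto simp: progressively_measurable_def)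
  then have "(\<lambda>s. p s \<omega>) \<in> borel_measurable (restrict_space borel {0..t})"
    using measurable_compose[OF measurable_Pair2'[of \<omega> "\<FF> t"], of _ "restrict_space borel {0..t}" borel]
      assms by (auto simp: space_filtration)
  then show ?thesis
    unfolding set_borel_measurable_def by (subst (asm) borel_measurable_restrict_space_iff) auto
qed

lemma adapted_shortfall:
  assumes filt: "filtered_prob_space M \<FF>" and Y: "adapted \<FF> Y"
    and cont: "\<And>\<omega>. \<omega> \<in> space M \<Longrightarrow> continuous_on {0..} (\<lambda>t. Y t \<omega>)"
  shows "adapted \<FF> (\<lambda>t \<omega>. shortfall (\<lambda>s. Y s \<omega>) t)"
  unfolding adapted_def
proof (intro allI impI)
  fix t :: real assume t: "0 \<le> t"
  have "(\<lambda>\<omega>. - (INF r\<in>{0..1} \<inter> \<rat>. min (Y (t * r) \<omega>) 0)) \<in> borel_measurable (\<FF> t)"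
  proof (intro borel_measurable_uminus borel_measurable_cINF_real borel_measurable_min)
    show "countable ({0..1} \<inter> \<rat> :: real set)" using countable_rat by auto
    fix r :: real assume "r \<in> {0..1} \<inter> \<rat>"
    then have "0 \<le> t * r" "t * r \<le> t" using t by (auto simp: mult_left_le)
    then show "Y (t * r) \<in> borel_measurable (\<FF> t)"
      using Y by (intro measurable_filtration_mono[OF filt, of "t * r" t]) (auto simp: adapted_def)
  qed auto
  then show "(\<lambda>\<omega>. shortfall (\<lambda>s. Y s \<omega>) t) \<in> borel_measurable (\<FF> t)"
    by (subst measurable_cong[OF shortfall_countable]) (auto simp: cont t space_filtration[OF filt])
qed

lemma pred_countable_Bex:
  assumes "countable X" and P: "\<And>i. i \<in> X \<Longrightarrow> Measurable.pred N (\<lambda>\<omega>. P i \<omega>)"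
  shows "Measurable.pred N (\<lambda>\<omega>. \<exists>i\<in>X. P i \<omega>)"
proof -
  have "{\<omega> \<in> space N. \<exists>i\<in>X. P i \<omega>} = (\<Union>i\<in>X. {\<omega> \<in> space N. P i \<omega>})" by auto
  then show ?thesis
    using assms by (auto simp: pred_def intro!: sets.countable_UN')
qed

text \<open>
  The assumption on \<open>T\<close> is weaker than being a stopping time, which matters for ruin times. It is
  enough because a continuous nondecreasing process stopped at \<open>T\<close> exceeds a level iff it does so
  at some time of a countable dense set that is not after \<open>T\<close>.
\<close>

lemma adapted_stopped:
  assumes filt: "filtered_prob_space M \<FF>" and N: "adapted \<FF> N"
    and T: "\<And>u. 0 \<le> u \<Longrightarrow> Measurable.pred (\<FF> u) (\<lambda>\<omega>. ennreal u \<le> T \<omega>)"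
    and cont: "\<And>\<omega>. \<omega> \<in> space M \<Longrightarrow> continuous_on {0..} (\<lambda>t. N t \<omega>)"
    and mono: "\<And>\<omega> s t. \<omega> \<in> space M \<Longrightarrow> 0 \<le> s \<Longrightarrow> s \<le> t \<Longrightarrow> N s \<omega> \<le> N t \<omega>"
  shows "adapted \<FF> (\<lambda>t \<omega>. N (stopped (T \<omega>) t) \<omega>)"
  unfolding adapted_def
proof (intro allI impI)
  fix t :: real assume t: "0 \<le> t"
  let ?Q = "{0..1} \<inter> \<rat> :: real set"
  have iff: "c < N (stopped (T \<omega>) t) \<omega> \<longleftrightarrow> (\<exists>r\<in>?Q. ennreal (t * r) \<le> T \<omega> \<and> c < N (t * r) \<omega>)"
    if \<omega>: "\<omega> \<in> space M" for c \<omega>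
  proof
    assume "\<exists>r\<in>?Q. ennreal (t * r) \<le> T \<omega> \<and> c < N (t * r) \<omega>"
    then obtain r where r: "r \<in> ?Q" "ennreal (t * r) \<le> T \<omega>" "c < N (t * r) \<omega>" by blast
    then have "0 \<le> t * r" "t * r \<le> t" using t by (auto simp: mult_left_le)
    then show "c < N (stopped (T \<omega>) t) \<omega>"
      using mono[OF \<omega>, of "t * r" "stopped (T \<omega>) t"] le_stopped_iff[OF t, of "t * r" "T \<omega>"] r by simp
  next
    assume c: "c < N (stopped (T \<omega>) t) \<omega>"
    let ?s = "stopped (T \<omega>) t"
    show "\<exists>r\<in>?Q. ennreal (t * r) \<le> T \<omega> \<and> c < N (t * r) \<omega>"
    proof (cases "?s = 0")
      case True
      then show ?thesis using c by (intro bexI[of _ 0]) auto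
    next
      case False
      then have s: "0 < ?s" "?s \<le> t" using stopped_nonneg[of "T \<omega>" t] stopped_le[OF t] by auto
      obtain \<delta> where \<delta>: "0 < \<delta>" "\<And>u. 0 \<le> u \<Longrightarrow> dist u ?s < \<delta> \<Longrightarrow> dist (N u \<omega>) (N ?s \<omega>) < N ?s \<omega> - c"
        using cont[OF \<omega>] s c unfolding continuous_on_iff
        by (metis atLeast_iff diff_gt_0_iff_gt less_imp_le)
      have "max 0 ((?s - \<delta>) / t) < ?s / t"
        using s \<delta>(1) by (auto simp: divide_less_cancel)
      then obtain r where r: "r \<in> \<rat>" "max 0 ((?s - \<delta>) / t) < r" "r < ?s / t"
        using Rats_dense_in_real by blast
      have "?s - \<delta> < t * r" "t * r < ?s"
        using r s by (auto simp: field_simps)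
      then have "dist (N (t * r) \<omega>) (N ?s \<omega>) < N ?s \<omega> - c"
        using r s t by (intro \<delta>(2)) (auto simp: dist_real_def)
      then have "c < N (t * r) \<omega>" by (auto simp: dist_real_def abs_if split: if_splits)
      moreover have "ennreal (t * r) \<le> T \<omega>"
        using \<open>t * r < ?s\<close> stopped_le_time[of "T \<omega>" t] by (meson ennreal_leI less_imp_le order_trans)
      moreover have "?s / t \<le> 1" using s by (simp add: divide_le_eq_1)
      ultimately show ?thesis using r by (intro bexI[of _ r]) auto
    qed
  qed
  show "(\<lambda>\<omega>. N (stopped (T \<omega>) t) \<omega>) \<in> borel_measurable (\<FF> t)"
    unfolding borel_measurable_iff_greater
  proof
    fix c
    have "Measurable.pred (\<FF> t) (\<lambda>\<omega>. \<exists>r\<in>?Q. ennreal (t * r) \<le> T \<omega> \<and> c < N (t * r) \<omega>)"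
    proof (intro pred_countable_Bex pred_intros_logic)
      show "countable ?Q" using countable_rat by auto
      fix r assume "r \<in> ?Q"
      then have r: "0 \<le> t * r" "t * r \<le> t" using t by (auto simp: mult_left_le)
      have sub: "subalgebra (\<FF> t) (\<FF> (t * r))"
        using filt r unfolding filtered_prob_space_def subalgebra_def filtration_def by auto
      show "Measurable.pred (\<FF> t) (\<lambda>\<omega>. ennreal (t * r) \<le> T \<omega>)"
        by (rule measurable_from_subalg[OF sub T[OF r(1)]])
      have [measurable]: "N (t * r) \<in> borel_measurable (\<FF> t)"
        using N r by (intro measurable_filtration_mono[OF filt r(2)]) (auto simp: adapted_def)
      show "Measurable.pred (\<FF> t) (\<lambda>\<omega>. c < N (t * r) \<omega>)"
        by measurable
    qed
    then have "{\<omega> \<in> space (\<FF> t). \<exists>r\<in>?Q. ennreal (t * r) \<le> T \<omega> \<and> c < N (t * r) \<omega>} \<in> sets (\<FF> t)"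
      by (simp add: pred_def)
    then show "{\<omega> \<in> space (\<FF> t). c < N (stopped (T \<omega>) t) \<omega>} \<in> sets (\<FF> t)"
      using iff by (simp add: space_filtration[OF filt] cong: conj_cong)
  qed
qed

lemma ext_stopping_time_pred_ge:
  assumes filt: "filtered_prob_space M \<FF>" and \<tau>: "ext_stopping_time \<FF> \<tau>" and u: "0 \<le> u"
  shows "Measurable.pred (\<FF> u) (\<lambda>\<omega>. ennreal u \<le> \<tau> \<omega>)"
proof -
  have iff: "ennreal u \<le> \<tau> \<omega> \<longleftrightarrow> \<not> (\<exists>r\<in>\<rat> \<inter> {0..<u}. \<tau> \<omega> \<le> ennreal r)" for \<omega>
  proof
    assume "\<not> (\<exists>r\<in>\<rat> \<inter> {0..<u}. \<tau> \<omega> \<le> ennreal r)"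
    then have no: "\<And>r. r \<in> \<rat> \<Longrightarrow> 0 \<le> r \<Longrightarrow> r < u \<Longrightarrow> ennreal r < \<tau> \<omega>" by (auto simp: not_le)
    show "ennreal u \<le> \<tau> \<omega>"
    proof (rule ccontr)
      assume "\<not> ennreal u \<le> \<tau> \<omega>"
      then obtain v where v: "\<tau> \<omega> = ennreal v" "0 \<le> v" "v < u"
        using u by (cases "\<tau> \<omega>") (auto simp: ennreal_less_iff not_le)
      then obtain r where "r \<in> \<rat>" "v < r" "r < u" using Rats_dense_in_real by blast
      with no[of r] v show False by (simp add: ennreal_less_iff)
    qed
  next
    assume u_le: "ennreal u \<le> \<tau> \<omega>"
    show "\<not> (\<exists>r\<in>\<rat> \<inter> {0..<u}. \<tau> \<omega> \<le> ennreal r)"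
    proof
      assume "\<exists>r\<in>\<rat> \<inter> {0..<u}. \<tau> \<omega> \<le> ennreal r"
      then obtain r where r: "0 \<le> r" "r < u" "\<tau> \<omega> \<le> ennreal r" by auto
      from u_le r(3) have "ennreal u \<le> ennreal r" by (rule order_trans)
      with r u show False by simp
    qed
  qed
  have "Measurable.pred (\<FF> u) (\<lambda>\<omega>. \<not> (\<exists>r\<in>\<rat> \<inter> {0..<u}. \<tau> \<omega> \<le> ennreal r))"
  proof (intro pred_intros_logic pred_countable_Bex)
    show "countable (\<rat> \<inter> {0..<u} :: real set)" using countable_rat by auto
    fix r :: real assume r: "r \<in> \<rat> \<inter> {0..<u}"
    have "subalgebra (\<FF> u) (\<FF> r)"
      using filt r unfolding filtered_prob_space_def subalgebra_def filtration_def by auto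
    then show "Measurable.pred (\<FF> u) (\<lambda>\<omega>. \<tau> \<omega> \<le> ennreal r)"
      by (rule measurable_from_subalg) (use \<tau> r in \<open>auto simp: ext_stopping_time_def\<close>)
  qed
  then show ?thesis by (simp add: iff)
qed

locale capped_reflection_process =
  fixes M :: "'a measure" and \<FF> :: "real \<Rightarrow> 'a measure" and f :: "real \<Rightarrow> real" and K :: real
    and Z A :: "real \<Rightarrow> 'a \<Rightarrow> real"
  assumes filt: "filtered_prob_space M \<FF>"
    and path: "\<And>\<omega>. \<omega> \<in> space M \<Longrightarrow> capped_reflection f K (\<lambda>t. Z t \<omega>) (\<lambda>t. A t \<omega>)"
    and Z: "adapted \<FF> Z"
    and A: "progressively_measurable \<FF> A"
begin

lemma f_measurable: "\<omega> \<in> space M \<Longrightarrow> f \<in> borel_measurable borel"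
  using capped_reflection.f_cont[OF path] by (rule borel_measurable_continuous_onI)

lemma adapted_net_path:
  assumes "progressively_measurable \<FF> p"
  shows "adapted \<FF> (\<lambda>t \<omega>. net_path (\<lambda>s. Z s \<omega>) (\<lambda>s. p s \<omega>) t)"
  using Z adapted_LBINT[OF assms] unfolding adapted_def net_path_def
  by (auto intro: borel_measurable_diff)

lemma continuous_net_path:
  assumes "locally_integrable (\<lambda>s. p s \<omega>)" "\<omega> \<in> space M"
  shows "continuous_on {0..} (net_path (\<lambda>s. Z s \<omega>) (\<lambda>s. p s \<omega>))"
  using assms by (intro continuous_on_net_path capped_reflection.z_cont[OF path])

lemma adapted_shortfall_net_path:
  assumes p: "progressively_measurable \<FF> p"
    and int: "\<And>\<omega>. \<omega> \<in> space M \<Longrightarrow> locally_integrable (\<lambda>s. p s \<omega>)"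
  shows "adapted \<FF> (\<lambda>t \<omega>. shortfall (net_path (\<lambda>s. Z s \<omega>) (\<lambda>s. p s \<omega>)) t)"
  using adapted_shortfall[OF filt adapted_net_path[OF p]] continuous_net_path[of p] int by simp

lemma progressively_measurable_reflected:
  assumes p: "progressively_measurable \<FF> p"
    and int: "\<And>\<omega>. \<omega> \<in> space M \<Longrightarrow> locally_integrable (\<lambda>s. p s \<omega>)"
  shows "progressively_measurable \<FF> (\<lambda>t \<omega>. reflected (net_path (\<lambda>s. Z s \<omega>) (\<lambda>s. p s \<omega>)) t)"
proof (rule progressively_measurable_continuous[OF filt])
  show "adapted \<FF> (\<lambda>t \<omega>. reflected (net_path (\<lambda>s. Z s \<omega>) (\<lambda>s. p s \<omega>)) t)"
    using adapted_net_path[OF p] adapted_shortfall_net_path[OF assms]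
    unfolding adapted_def reflected_def by (auto intro: borel_measurable_add)
  show "continuous_on {0..} (\<lambda>t. reflected (net_path (\<lambda>s. Z s \<omega>) (\<lambda>s. p s \<omega>)) t)"
    if "\<omega> \<in> space M" for \<omega>
    using capped_reflection.reflected_net_path_cont[OF path int] that by simp
qed

lemma progressively_measurable_iteration:
  "progressively_measurable \<FF> (\<lambda>t \<omega>. capped_iteration f (\<lambda>s. Z s \<omega>) (\<lambda>s. A s \<omega>) n t)"
proof (induction n)
  case 0
  then show ?case by (simp add: capped_iteration.simps progressively_measurable_def case_prod_beta)
next
  case (Suc n)
  let ?p = "\<lambda>t \<omega>. capped_iteration f (\<lambda>s. Z s \<omega>) (\<lambda>s. A s \<omega>) n t"
  have R: "progressively_measurable \<FF> (\<lambda>t \<omega>. reflected (net_path (\<lambda>s. Z s \<omega>) (\<lambda>s. ?p s \<omega>)) t)"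
    using capped_reflection.iter_integrable[OF path] by (intro progressively_measurable_reflected Suc) auto
  show ?case
    unfolding progressively_measurable_def
  proof (intro allI impI)
    fix t :: real assume t: "0 \<le> t"
    let ?N = "restrict_space borel {0..t} \<Otimes>\<^sub>M \<FF> t"
    show "(\<lambda>(s, \<omega>). capped_iteration f (\<lambda>s. Z s \<omega>) (\<lambda>s. A s \<omega>) (Suc n) s) \<in> borel_measurable ?N"
    proof (cases "space M = {}")
      case True
      then have "space ?N = {}" by (simp add: space_pair_measure space_filtration[OF filt])
      then show ?thesis unfolding measurable_def by simp
    next
      case False
      then have f: "f \<in> borel_measurable borel" using f_measurable by auto
      have "(\<lambda>p. f ((\<lambda>(s, \<omega>). reflected (net_path (\<lambda>s. Z s \<omega>) (\<lambda>s. ?p s \<omega>)) s) p)) \<in> borel_measurable ?N"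
        using R t by (intro measurable_compose[OF _ f]) (auto simp: progressively_measurable_def)
      moreover have "(\<lambda>(s, \<omega>). A s \<omega>) \<in> borel_measurable ?N"
        using A t by (auto simp: progressively_measurable_def)
      ultimately have "(\<lambda>p. min ((\<lambda>(s, \<omega>). A s \<omega>) p)
          (f ((\<lambda>(s, \<omega>). reflected (net_path (\<lambda>s. Z s \<omega>) (\<lambda>s. ?p s \<omega>)) s) p))) \<in> borel_measurable ?N"
        by (intro borel_measurable_min)
      then show ?thesis by (simp add: capped_iteration.simps case_prod_beta)
    qed
  qed
qed

lemma progressively_measurable_capped_rate:
  "progressively_measurable \<FF> (\<lambda>t \<omega>. capped_rate f (\<lambda>s. Z s \<omega>) (\<lambda>s. A s \<omega>) t)"
  unfolding progressively_measurable_def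
proof (intro allI impI)
  fix t :: real assume "0 \<le> t"
  then have "(\<lambda>p. lim (\<lambda>n. (\<lambda>(s, \<omega>). capped_iteration f (\<lambda>s. Z s \<omega>) (\<lambda>s. A s \<omega>) n s) p))
      \<in> borel_measurable (restrict_space borel {0..t} \<Otimes>\<^sub>M \<FF> t)"
    using progressively_measurable_iteration unfolding progressively_measurable_def
    by (intro borel_measurable_lim_metric) auto
  then show "(\<lambda>(s, \<omega>). capped_rate f (\<lambda>s. Z s \<omega>) (\<lambda>s. A s \<omega>) s)
      \<in> borel_measurable (restrict_space borel {0..t} \<Otimes>\<^sub>M \<FF> t)"
    by (simp add: capped_rate_def case_prod_beta)
qed

end

section \<open>Discounted payments as averages of accumulated payments\<close>

text \<open>
  Integration by parts in the form of Tonelli's theorem: a discount factor is the tail mass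
  \<open>exp (- q * t) = \<integral>\<^sub>t\<^sup>\<infinity> q * exp (- q * s) ds\<close>. Infinite totals are covered.
\<close>

lemma nn_integral_discount:
  assumes N: "sigma_finite_measure N" "sets N = sets borel" and q: "0 < q"
  shows "(\<integral>\<^sup>+t\<in>{t. 0 \<le> t \<and> ennreal t \<le> T}. ennreal (exp (- q * t)) \<partial>N) =
    (\<integral>\<^sup>+s\<in>{0..}. ennreal (q * exp (- q * s)) * emeasure N {0..stopped T s} \<partial>lborel)"
proof -
  interpret N: sigma_finite_measure N by fact
  interpret P: pair_sigma_finite N "lborel :: real measure"
    by unfold_locales
  have space_N: "space N = UNIV" using sets_eq_imp_space_eq[OF N(2)] by simp
  let ?A = "{t. 0 \<le> t \<and> ennreal t \<le> T}"
  have [measurable]: "?A \<in> sets borel" by measurable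
  have tail: "ennreal (exp (- q * t)) = (\<integral>\<^sup>+s. ennreal (q * exp (- q * s)) * indicator {t..} s \<partial>lborel)" for t
  proof -
    have "((\<lambda>s. - exp (- q * s)) \<longlongrightarrow> - 0) at_top"
      using q by (intro tendsto_minus filterlim_compose[OF exp_at_bot]
        filterlim_tendsto_neg_mult_at_bot[OF tendsto_const _ filterlim_ident]) auto
    then show ?thesis
      by (subst nn_integral_FTC_atLeast[where F = "\<lambda>s. - exp (- q * s)" and T = 0])
         (use q in \<open>auto intro!: derivative_eq_intros\<close>)
  qed
  let ?h = "\<lambda>t s. ennreal (q * exp (- q * s)) * indicator {t..} s * indicator ?A t"
  have [measurable]: "(\<lambda>(t, s). ?h t s) \<in> borel_measurable (N \<Otimes>\<^sub>M lborel)"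
  proof -
    have "(\<lambda>(t, s). ?h t s) =
        (\<lambda>p. ennreal (q * exp (- q * snd p)) * indicator {p. fst p \<le> snd p} p * indicator ?A (fst p))"
      by (auto simp: indicator_def)
    also have "\<dots> \<in> borel_measurable (borel \<Otimes>\<^sub>M borel)"
      by measurable
    also have "borel_measurable (borel \<Otimes>\<^sub>M borel) = borel_measurable (N \<Otimes>\<^sub>M (lborel :: real measure))"
      by (intro measurable_cong_sets sets_pair_measure_cong) (auto simp: N)
    finally show ?thesis .
  qed
  have "(\<integral>\<^sup>+t\<in>?A. ennreal (exp (- q * t)) \<partial>N) = (\<integral>\<^sup>+t. \<integral>\<^sup>+s. ?h t s \<partial>lborel \<partial>N)"
    unfolding tail by (intro nn_integral_cong nn_integral_multc[symmetric]) measurable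
  also have "\<dots> = (\<integral>\<^sup>+s. \<integral>\<^sup>+t. ?h t s \<partial>N \<partial>lborel)"
    by (rule P.Fubini'[symmetric]) measurable
  also have "\<dots> = (\<integral>\<^sup>+s\<in>{0..}. ennreal (q * exp (- q * s)) * emeasure N {0..stopped T s} \<partial>lborel)"
  proof (intro nn_integral_cong)
    fix s :: real
    show "(\<integral>\<^sup>+t. ?h t s \<partial>N) =
        ennreal (q * exp (- q * s)) * emeasure N {0..stopped T s} * indicator {0..} s"
    proof (cases "0 \<le> s")
      case True
      have "(\<integral>\<^sup>+t. ?h t s \<partial>N) = (\<integral>\<^sup>+t. ennreal (q * exp (- q * s)) * indicator {0..stopped T s} t \<partial>N)"
        using le_stopped_iff[OF True] by (intro nn_integral_cong) (auto simp: indicator_def)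
      with True show ?thesis by (simp add: nn_integral_cmult_indicator N)
    next
      case False
      then show ?thesis by (auto simp: indicator_def intro!: nn_integral_zero')
    qed
  qed
  finally show ?thesis .
qed

text \<open>
  The interval is closed on the left to include the atom of mass \<open>G 0\<close> at \<open>0\<close>.
\<close>

lemma emeasure_interval_measure_from_0:
  fixes G :: "real \<Rightarrow> real"
  assumes "mono G" "\<And>t. continuous (at_right t) G" "\<And>t. t < 0 \<Longrightarrow> G t = 0" "0 \<le> b"
  shows "emeasure (interval_measure G) {0..b} = ennreal (G b)"
proof -
  let ?A = "\<lambda>n. {- inverse (real (Suc n))<..b}"
  have val: "emeasure (interval_measure G) (?A n) = ennreal (G b)" for n
  proof -
    have neg: "- inverse (real (Suc n)) < 0" by simp
    then have "G (- inverse (real (Suc n))) = 0" by (rule assms(3))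
    moreover have "- inverse (real (Suc n)) \<le> b" using neg assms(4) by linarith
    ultimately show ?thesis
      using emeasure_interval_measure_Ioc[of "- inverse (real (Suc n))" b G] monoD[OF assms(1)] assms(2)
      by simp
  qed
  have "(\<Inter>n. ?A n) = {0..b}"
  proof (intro equalityI subsetI)
    fix x assume x: "x \<in> (\<Inter>n. ?A n)"
    have mem: "x \<in> ?A n" for n using x by (rule INT_D) simp
    have "0 \<le> x"
    proof (rule ccontr)
      assume "\<not> 0 \<le> x"
      then obtain n where "inverse (real (Suc n)) < - x"
        using reals_Archimedean[of "- x"] by auto
      moreover have "- inverse (real (Suc n)) < x" using mem[of n] by simp
      ultimately show False by linarith
    qed
    with mem[of 0] show "x \<in> {0..b}" by simp
  next
    fix x assume x: "x \<in> {0..b}"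
    have "- inverse (real (Suc n)) < x" for n
      using x less_le_trans[of "- inverse (real (Suc n))" 0 x] by simp
    with x show "x \<in> (\<Inter>n. ?A n)" by simp
  qed
  moreover have "(INF n. emeasure (interval_measure G) (?A n)) = emeasure (interval_measure G) (\<Inter>n. ?A n)"
  proof (rule INF_emeasure_decseq)
    show "decseq ?A"
    proof (rule decseq_SucI)
      show "?A (Suc n) \<subseteq> ?A n" for n
      proof -
        have "inverse (real (Suc (Suc n))) \<le> inverse (real (Suc n))"
          by (rule le_imp_inverse_le) auto
        then have "- inverse (real (Suc n)) \<le> - inverse (real (Suc (Suc n)))"
          by (rule le_imp_neg_le)
        then show ?thesis
          unfolding subset_iff greaterThanAtMost_iff by (meson order.strict_trans1)
      qed
    qed
  qed (auto simp: val simp del: of_nat_Suc)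
  ultimately show ?thesis unfolding val by simp
qed

lemma discounted_injections_eq:
  assumes "mono (\<lambda>t. G t \<omega>)" "\<And>t. continuous (at_right t) (\<lambda>t. G t \<omega>)" "\<And>t. t < 0 \<Longrightarrow> G t \<omega> = 0"
    and q: "0 < q"
  shows "discounted_injections q G T \<omega> =
    (\<integral>\<^sup>+s\<in>{0..}. ennreal (q * exp (- q * s)) * ennreal (G (stopped T s) \<omega>) \<partial>lborel)"
proof -
  have sf: "sigma_finite_measure (interval_measure (\<lambda>t. G t \<omega>))"
    using assms by (intro sigma_finite_interval_measure) (auto intro: monoD)
  show ?thesis
    unfolding discounted_injections_def
    by (subst nn_integral_discount[OF sf _ q])
       (simp_all add: emeasure_interval_measure_from_0[OF assms(1-3) stopped_nonneg])
qed

lemma discounted_dividends_eq: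
  assumes int: "locally_integrable (\<lambda>t. l t \<omega>)" and nonneg: "\<And>t. 0 \<le> t \<Longrightarrow> 0 \<le> l t \<omega>" and q: "0 < q"
  shows "discounted_dividends q l T \<omega> =
    (\<integral>\<^sup>+s\<in>{0..}. ennreal (q * exp (- q * s)) * ennreal (LBINT u:{0..stopped T s}. l u \<omega>) \<partial>lborel)"
proof -
  define g where "g t = ennreal (indicator {0..} t * l t \<omega>)" for t
  have "(\<lambda>t. indicator {0..} t * l t \<omega>) \<in> borel_measurable lborel"
  proof (rule borel_measurable_LIMSEQ_real)
    show "(\<lambda>n. indicator {0..real n} t * l t \<omega>) \<longlonglongrightarrow> indicator {0..} t * l t \<omega>" for t
    proof (rule tendsto_eventually)
      obtain m where "t \<le> real m" using real_arch_simple by blast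
      then have "\<And>n. m \<le> n \<Longrightarrow> t \<le> real n" by (meson of_nat_mono order_trans)
      then show "\<forall>\<^sub>F n in sequentially. indicator {0..real n} t * l t \<omega> = indicator {0..} t * l t \<omega>"
        by (intro eventually_sequentiallyI[of m]) (auto simp: indicator_def)
    qed
    show "(\<lambda>t. indicator {0..real n} t * l t \<omega>) \<in> borel_measurable lborel" for n
      using int by (auto simp: set_integrable_def dest!: spec[of _ "real n"])
  qed
  then have g[measurable]: "g \<in> borel_measurable lborel"
    unfolding g_def by measurable
  let ?N = "density lborel g"
  have sf: "sigma_finite_measure ?N"
    using sigma_finite_measure.sigma_finite_iff_density_finite[OF lborel.sigma_finite_measure_axioms g] by (simp add: g_def)
  have "discounted_dividends q l T \<omega> = (\<integral>\<^sup>+t\<in>{t. 0 \<le> t \<and> ennreal t \<le> T}. ennreal (exp (- q * t)) \<partial>?N)"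
    unfolding discounted_dividends_def
    by (subst nn_integral_density[OF g])
       (auto simp: g_def indicator_def ennreal_mult nonneg mult.commute intro!: nn_integral_cong)
  also have "\<dots> = (\<integral>\<^sup>+s\<in>{0..}. ennreal (q * exp (- q * s)) * emeasure ?N {0..stopped T s} \<partial>lborel)"
    by (rule nn_integral_discount[OF sf _ q]) simp
  finally have eq: "discounted_dividends q l T \<omega> = \<dots>" .
  have "emeasure ?N {0..b} = ennreal (LBINT u:{0..b}. l u \<omega>)" if b: "0 \<le> b" for b
  proof -
    have "emeasure ?N {0..b} = (\<integral>\<^sup>+u. ennreal (indicator {0..b} u *\<^sub>R l u \<omega>) \<partial>lborel)"
      by (subst emeasure_density) (auto simp: g_def indicator_def intro!: nn_integral_cong)
    also have "\<dots> = ennreal (LBINT u:{0..b}. l u \<omega>)"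
      unfolding set_lebesgue_integral_def using int b nonneg
      by (intro nn_integral_eq_integral) (auto simp: set_integrable_def indicator_def)
    finally show ?thesis .
  qed
  then show ?thesis by (simp add: eq stopped_nonneg)
qed

text \<open>
  The assumptions compare accumulated amounts at each time. Averaging them gives
  \<open>D + J' \<le> D' + J + \<epsilon>\<close> and \<open>J' \<le> J + \<epsilon>\<close> for the discounted dividends \<open>D\<close>, \<open>D'\<close> and injections \<open>J\<close>, \<open>J'\<close>. The first
  inequality plus \<open>\<beta> - 1\<close> times the second one is the claim.
\<close>

lemma net_payoff_le:
  assumes l: "locally_integrable (\<lambda>t. l t \<omega>)" "\<And>t. 0 \<le> t \<Longrightarrow> 0 \<le> l t \<omega>"
    and l': "locally_integrable (\<lambda>t. l' t \<omega>)" "\<And>t. 0 \<le> t \<Longrightarrow> 0 \<le> l' t \<omega>"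
    and G: "mono (\<lambda>t. G t \<omega>)" "\<And>t. continuous (at_right t) (\<lambda>t. G t \<omega>)" "\<And>t. t < 0 \<Longrightarrow> G t \<omega> = 0"
    and G': "mono (\<lambda>t. G' t \<omega>)" "\<And>t. continuous (at_right t) (\<lambda>t. G' t \<omega>)" "\<And>t. t < 0 \<Longrightarrow> G' t \<omega> = 0"
    and q: "0 < q" and \<beta>: "1 \<le> \<beta>" and \<epsilon>: "0 \<le> \<epsilon>"
    and budget: "\<And>s. 0 \<le> s \<Longrightarrow> (LBINT u:{0..stopped T s}. l u \<omega>) + G' (stopped T' s) \<omega>
      \<le> (LBINT u:{0..stopped T' s}. l' u \<omega>) + G (stopped T s) \<omega> + \<epsilon>"
    and inj: "\<And>s. 0 \<le> s \<Longrightarrow> G' (stopped T' s) \<omega> \<le> G (stopped T s) \<omega> + \<epsilon>"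
  shows "net_payoff q \<beta> l G T \<omega> \<le> net_payoff q \<beta> l' G' T' \<omega> + ereal (\<beta> * \<epsilon>)"
proof -
  have G_nonneg: "0 \<le> G t \<omega>" for t
  proof -
    have "G (min t (-1)) \<omega> \<le> G t \<omega>" by (rule monoD[OF G(1)]) simp
    then show ?thesis using G(3)[of "min t (-1)"] by simp
  qed
  have G'_nonneg: "0 \<le> G' t \<omega>" for t
  proof -
    have "G' (min t (-1)) \<omega> \<le> G' t \<omega>" by (rule monoD[OF G'(1)]) simp
    then show ?thesis using G'(3)[of "min t (-1)"] by simp
  qed
  let ?L = "\<lambda>s. LBINT u:{0..stopped T s}. l u \<omega>" and ?L' = "\<lambda>s. LBINT u:{0..stopped T' s}. l' u \<omega>"
  let ?g = "\<lambda>s. G (stopped T s) \<omega>" and ?g' = "\<lambda>s. G' (stopped T' s) \<omega>"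
  let ?I = "\<lambda>h. \<integral>\<^sup>+s\<in>{0..}. ennreal (q * exp (- q * s)) * ennreal (h s) \<partial>lborel"
  have "mono ?L" "mono ?L'"
    using l l' by (auto intro!: monoI LBINT_mono_interval stopped_nonneg stopped_mono)
  moreover have "mono ?g" "mono ?g'"
    using G(1) G'(1) by (auto intro!: monoI stopped_mono elim: monoD)
  ultimately have [measurable]: "?L \<in> borel_measurable borel" "?L' \<in> borel_measurable borel"
      "?g \<in> borel_measurable borel" "?g' \<in> borel_measurable borel"
    by (simp_all add: borel_measurable_mono)
  have L_nonneg: "0 \<le> ?L s" "0 \<le> ?L' s" for s
    by (rule LBINT_nonneg_on, simp add: l(2) l'(2))+
  have I_add: "?I h + ?I k = ?I (\<lambda>s. h s + k s)"
    if [measurable]: "h \<in> borel_measurable borel" "k \<in> borel_measurable borel"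
      and "\<And>s. 0 \<le> h s" "\<And>s. 0 \<le> k s" for h k :: "real \<Rightarrow> real"
    using that(3,4) by (subst nn_integral_add[symmetric])
      (auto intro!: nn_integral_cong simp: distrib_left distrib_right ennreal_plus)
  have I_const: "?I (\<lambda>_. \<epsilon>) = ennreal \<epsilon>"
  proof -
    have "((\<lambda>s. - exp (- q * s) * \<epsilon>) \<longlongrightarrow> - 0 * \<epsilon>) at_top"
      using q by (intro tendsto_mult tendsto_const tendsto_minus filterlim_compose[OF exp_at_bot]
        filterlim_tendsto_neg_mult_at_bot[OF tendsto_const _ filterlim_ident]) auto
    then have "(\<integral>\<^sup>+s. ennreal (q * exp (- q * s) * \<epsilon>) * indicator {0..} s \<partial>lborel) = ennreal \<epsilon>"
      by (subst nn_integral_FTC_atLeast[where F = "\<lambda>s. - exp (- q * s) * \<epsilon>" and T = 0])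
         (use q \<epsilon> in \<open>auto intro!: derivative_eq_intros\<close>)
    then show ?thesis using q \<epsilon> by (simp add: ennreal_mult)
  qed
  have I_mono: "?I h \<le> ?I k" if "\<And>s. 0 \<le> s \<Longrightarrow> h s \<le> k s" for h k :: "real \<Rightarrow> real"
    using that by (intro nn_integral_mono) (auto simp: indicator_def intro!: mult_left_mono ennreal_leI)
  define D D' J J' where "D = ?I ?L" and "D' = ?I ?L'" and "J = ?I ?g" and "J' = ?I ?g'"
  have eqs: "discounted_dividends q l T \<omega> = D" "discounted_dividends q l' T' \<omega> = D'"
      "discounted_injections q G T \<omega> = J" "discounted_injections q G' T' \<omega> = J'"
    unfolding D_def D'_def J_def J'_def
    by (intro discounted_dividends_eq discounted_injections_eq l l' G G' q; assumption)+
  have 1: "D + J' \<le> D' + J + ennreal \<epsilon>"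
  proof -
    have "D + J' = ?I (\<lambda>s. ?L s + ?g' s)"
      unfolding D_def J'_def by (rule I_add) (auto simp: L_nonneg G'_nonneg)
    also have "\<dots> \<le> ?I (\<lambda>s. ?L' s + ?g s + \<epsilon>)"
      by (rule I_mono) (rule budget)
    also have "\<dots> = ?I (\<lambda>s. ?L' s + ?g s) + ?I (\<lambda>_. \<epsilon>)"
      by (rule I_add[symmetric]) (auto simp: L_nonneg G_nonneg \<epsilon>)
    also have "?I (\<lambda>s. ?L' s + ?g s) = D' + J"
      unfolding D'_def J_def by (rule I_add[symmetric]) (auto simp: L_nonneg G_nonneg)
    also note I_const
    finally show ?thesis .
  qed
  have 2: "J' \<le> J + ennreal \<epsilon>"
  proof -
    have "J' \<le> ?I (\<lambda>s. ?g s + \<epsilon>)"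
      unfolding J'_def by (rule I_mono) (rule inj)
    also have "\<dots> = ?I ?g + ?I (\<lambda>_. \<epsilon>)"
      by (rule I_add[symmetric]) (auto simp: G_nonneg \<epsilon>)
    also note I_const
    also note J_def[symmetric]
    finally show ?thesis .
  qed
  show ?thesis
  proof (cases J)
    case top
    then show ?thesis by (simp add: net_payoff_def eqs)
  next
    case (real j)
    then obtain j' where j': "J' = ennreal j'" "0 \<le> j'" "j' \<le> j + \<epsilon>"
      using 2 \<epsilon> by (cases J') (auto simp: top_unique simp flip: ennreal_plus)
    show ?thesis
    proof (cases D')
      case top
      then show ?thesis using j' by (simp add: net_payoff_def eqs)
    next
      case (real d')
      then obtain d where d: "D = ennreal d" "0 \<le> d" "d + j' \<le> d' + j + \<epsilon>"
        using 1 \<epsilon> j' \<open>J = ennreal j\<close> \<open>0 \<le> j\<close>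
        by (cases D) (auto simp: top_unique simp flip: ennreal_plus)
      have "(\<beta> - 1) * j' \<le> (\<beta> - 1) * (j + \<epsilon>)"
        using j' \<beta> by (intro mult_left_mono) auto
      with d(3) have "d - \<beta> * j \<le> d' - \<beta> * j' + \<beta> * \<epsilon>"
        by (simp add: algebra_simps)
      then show ?thesis
        using d j' real \<open>J = ennreal j\<close> \<open>0 \<le> j\<close> by (simp add: net_payoff_def eqs)
    qed
  qed
qed

section \<open>Expectations of possibly non-measurable payoffs\<close>

text \<open>
  For a non-measurable integrand the integral is a lower integral, which need not be additive, but
  it does split off constants: a simple function below \<open>h + c\<close> is, after truncated subtraction
  of \<open>c\<close>, one below \<open>h\<close>.
\<close>

lemma nn_integral_add_const_le:
  assumes "prob_space M"
  shows "(\<integral>\<^sup>+\<omega>. h \<omega> + c \<partial>M) \<le> (\<integral>\<^sup>+\<omega>. h \<omega> \<partial>M) + c"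
  unfolding nn_integral_def_finite[of M "\<lambda>\<omega>. h \<omega> + c"]
proof (rule SUP_least, clarify)
  interpret prob_space M by fact
  fix g assume g: "simple_function M g" "g \<le> (\<lambda>\<omega>. h \<omega> + c)" and fin: "\<forall>x. g x < top"
  have g': "simple_function M (\<lambda>\<omega>. g \<omega> - c)"
    using simple_function_compose1[OF g(1), of "\<lambda>x. x - c"] by simp
  have "integral\<^sup>S M g = (\<integral>\<^sup>+\<omega>. g \<omega> \<partial>M)"
    using g(1) by (simp add: nn_integral_eq_simple_integral)
  also have "\<dots> \<le> (\<integral>\<^sup>+\<omega>. (g \<omega> - c) + c \<partial>M)"
    by (intro nn_integral_mono) (auto simp: diff_add_self_ennreal)
  also have "\<dots> = (\<integral>\<^sup>+\<omega>. g \<omega> - c \<partial>M) + c"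
    using borel_measurable_simple_function[OF g'] by (subst nn_integral_add) (auto simp: emeasure_space_1)
  also have "(\<integral>\<^sup>+\<omega>. g \<omega> - c \<partial>M) \<le> (\<integral>\<^sup>+\<omega>. h \<omega> \<partial>M)"
    using g(2) fin by (intro nn_integral_mono) (auto simp: le_fun_def ennreal_minus_le_iff add.commute fin[rule_format, THEN less_imp_neq])
  finally show "integral\<^sup>S M g \<le> (\<integral>\<^sup>+\<omega>. h \<omega> \<partial>M) + c"
    by (simp add: add_right_mono)
qed

text \<open>
  The factor \<open>2\<close> arises because the positive and negative parts are integrated separately, each
  with an error \<open>c\<close>.
\<close>

lemma ereal_expectation_le_add:
  assumes M: "prob_space M" and c: "0 \<le> c"
    and le: "\<And>\<omega>. \<omega> \<in> space M \<Longrightarrow> Z \<omega> \<le> Z' \<omega> + ereal c"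
  shows "ereal_expectation M Z \<le> ereal_expectation M Z' + ereal (2 * c)"
proof -
  let ?p = "\<integral>\<^sup>+\<omega>. e2ennreal (Z \<omega>) \<partial>M" and ?p' = "\<integral>\<^sup>+\<omega>. e2ennreal (Z' \<omega>) \<partial>M"
  let ?n = "\<integral>\<^sup>+\<omega>. e2ennreal (- Z \<omega>) \<partial>M" and ?n' = "\<integral>\<^sup>+\<omega>. e2ennreal (- Z' \<omega>) \<partial>M"
  have add: "e2ennreal (y + ereal c) \<le> e2ennreal y + ennreal c" for y
  proof (cases "0 \<le> y")
    case True
    then show ?thesis using c by (cases y) (auto simp flip: ennreal_plus)
  next
    case False
    then have "y + ereal c \<le> ereal c" by (cases y) auto
    then show ?thesis using e2ennreal_mono by (fastforce intro: order_trans[OF _ add_increasing])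
  qed
  have pos: "?p \<le> ?p' + ennreal c"
  proof -
    have "?p \<le> (\<integral>\<^sup>+\<omega>. e2ennreal (Z' \<omega>) + ennreal c \<partial>M)"
      by (intro nn_integral_mono order_trans[OF e2ennreal_mono[OF le] add])
    also have "\<dots> \<le> ?p' + ennreal c" by (rule nn_integral_add_const_le[OF M])
    finally show ?thesis .
  qed
  have neg: "?n' \<le> ?n + ennreal c"
  proof -
    have "- Z' \<omega> \<le> - Z \<omega> + ereal c" if "\<omega> \<in> space M" for \<omega>
      using le[OF that] by (cases "Z \<omega>"; cases "Z' \<omega>") auto
    then have "?n' \<le> (\<integral>\<^sup>+\<omega>. e2ennreal (- Z \<omega>) + ennreal c \<partial>M)"
      by (intro nn_integral_mono order_trans[OF e2ennreal_mono add])
    also have "\<dots> \<le> ?n + ennreal c" by (rule nn_integral_add_const_le[OF M])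
    finally show ?thesis .
  qed
  show ?thesis
  proof (cases ?n)
    case top
    then show ?thesis by (simp add: ereal_expectation_def)
  next
    case (real n)
    then obtain n' where n': "?n' = ennreal n'" "0 \<le> n'" "n' \<le> n + c"
      using neg c by (cases ?n') (auto simp: top_unique simp flip: ennreal_plus)
    show ?thesis
    proof (cases ?p')
      case top
      then show ?thesis using n' by (simp add: ereal_expectation_def)
    next
      case (real p')
      then obtain p where "?p = ennreal p" "0 \<le> p" "p \<le> p' + c"
        using pos c by (cases ?p) (auto simp: top_unique simp flip: ennreal_plus)
      then show ?thesis
        using n' real \<open>?n = ennreal n\<close> \<open>0 \<le> n\<close> by (simp add: ereal_expectation_def)
    qed
  qed
qed

section \<open>Lipschitz bound for the dividend cap\<close>

text \<open>
  By concavity all chords of \<open>F\<close> have slopes at most the derivative of \<open>F\<close> at \<open>0\<close>, and by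
  monotonicity they are nonnegative. The composition with \<open>max 0\<close> extends \<open>F\<close> to the real line as a
  nondecreasing Lipschitz function.
\<close>

lemma concave_mono_C1_lipschitz:
  assumes mono: "mono_on {0..} F" and conc: "concave_on {0..} F" and C1: "C1_on_nonneg F"
  obtains K where "0 < K" "\<And>x y. \<bar>F (max 0 x) - F (max 0 y)\<bar> \<le> K * \<bar>x - y\<bar>"
proof -
  obtain D where D: "(F has_real_derivative D) (at 0 within {0..})"
    using C1 unfolding C1_on_nonneg_def by force
  have lim: "((\<lambda>h. (F h - F 0) / h) \<longlongrightarrow> D) (at_right 0)"
    using D unfolding has_field_derivative_iff at_within_Ici_at_right by simp
  have cvx: "convex_on {0..} (\<lambda>x. - F x)"
    using conc by (simp add: concave_on_def)
  have chord: "(F v - F u) / (v - u) \<le> (F h - F 0) / h" if "0 \<le> u" "0 < h" "h < (if u = 0 then v else u)" "u < v" for u v h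
  proof (cases "u = 0")
    case True
    then show ?thesis
      using convex_on_slope_le(1)[OF cvx, of 0 v h] that by (simp add: field_simps)
  next
    case False
    have 1: "(F u - F 0) / u \<le> (F h - F 0) / h"
      using convex_on_slope_le(1)[OF cvx, of 0 u h] that False by (simp add: field_simps)
    have "(F v - F 0) / v \<le> (F u - F 0) / u"
      using convex_on_slope_le(1)[OF cvx, of 0 v u] that False by (simp add: field_simps)
    moreover have "(F v - F u) / (v - u) \<le> (F v - F 0) / v"
      using convex_on_slope_le(2)[OF cvx, of 0 v u] that False
      by (simp add: minus_divide_left[symmetric] minus_divide_divide[symmetric, of "F v - F u"])
         (simp add: field_simps)
    ultimately show ?thesis using 1 by linarith
  qed
  have slope: "F v - F u \<le> D * (v - u)" if "0 \<le> u" "u < v" for u v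
  proof -
    have "(F v - F u) / (v - u) \<le> D"
    proof (rule tendsto_lowerbound[OF lim])
      have "\<forall>\<^sub>F h in at_right 0. h \<in> {0<..<(if u = 0 then v else u)}"
        using that by (intro eventually_at_right_real) auto
      then show "\<forall>\<^sub>F h in at_right 0. (F v - F u) / (v - u) \<le> (F h - F 0) / h"
        by eventually_elim (use chord[OF that(1) _ _ that(2)] in auto)
    qed simp
    then show ?thesis using that by (simp add: field_simps)
  qed
  show thesis
  proof
    show "0 < \<bar>D\<bar> + 1" by simp
    have *: "\<bar>F (max 0 v) - F (max 0 u)\<bar> \<le> (\<bar>D\<bar> + 1) * \<bar>v - u\<bar>" if "u \<le> v" for u v :: real
    proof (cases "max 0 u < max 0 v")
      case True
      have "0 \<le> F (max 0 v) - F (max 0 u)"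
        using mono_onD[OF mono _ _ less_imp_le[OF True]] by auto
      moreover have "F (max 0 v) - F (max 0 u) \<le> D * (max 0 v - max 0 u)"
        using slope[OF _ True] by simp
      moreover have "D * (max 0 v - max 0 u) \<le> (\<bar>D\<bar> + 1) * (v - u)"
        using that True by (intro mult_mono) auto
      ultimately show ?thesis using that by simp
    next
      case False
      then have "max 0 u = max 0 v" using that by auto
      then show ?thesis by simp
    qed
    show "\<bar>F (max 0 x) - F (max 0 y)\<bar> \<le> (\<bar>D\<bar> + 1) * \<bar>x - y\<bar>" for x y :: real
      using *[of x y] *[of y x] by (cases "x \<le> y") (auto simp: abs_minus_commute)
  qed
qed

section \<open>The controlled process\<close>

locale dividend_model =
  fixes M :: "'a measure" and \<FF> :: "real \<Rightarrow> 'a measure" and B :: "real \<Rightarrow> 'a \<Rightarrow> real"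
    and \<mu> \<sigma> q \<beta> K :: real and F :: "real \<Rightarrow> real" and x :: real
  assumes filt: "filtered_prob_space M \<FF>"
    and B_adapted: "adapted \<FF> B"
    and B_0: "\<And>\<omega>. \<omega> \<in> space M \<Longrightarrow> B 0 \<omega> = 0"
    and B_cont: "\<And>\<omega>. \<omega> \<in> space M \<Longrightarrow> continuous_on {0..} (\<lambda>t. B t \<omega>)"
    and q: "0 < q" and \<beta>: "1 \<le> \<beta>" and x: "0 \<le> x"
    and F_nonneg: "\<And>y. 0 \<le> y \<Longrightarrow> 0 \<le> F y"
    and F_mono: "mono_on {0..} F"
    and K: "0 < K" "\<And>y z. \<bar>F (max 0 y) - F (max 0 z)\<bar> \<le> K * \<bar>y - z\<bar>"
begin

definition free_path :: "real \<Rightarrow> 'a \<Rightarrow> real" where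
  "free_path t \<omega> = x + \<mu> * t + \<sigma> * B t \<omega>"

abbreviation F0 :: "real \<Rightarrow> real" where
  "F0 y \<equiv> F (max 0 y)"

abbreviation path :: "(real \<Rightarrow> 'a \<Rightarrow> real) \<Rightarrow> 'a \<Rightarrow> real \<Rightarrow> real" where
  "path l \<omega> \<equiv> net_path (\<lambda>s. free_path s \<omega>) (\<lambda>s. l s \<omega>)"

lemma prob_space_M: "prob_space M"
  using filt by (simp add: filtered_prob_space_def)

lemma free_path_adapted: "adapted \<FF> free_path"
proof -
  have "(\<lambda>\<omega>. x + \<mu> * t + \<sigma> * B t \<omega>) \<in> borel_measurable (\<FF> t)" if "0 \<le> t" for t
  proof -
    have [measurable]: "B t \<in> borel_measurable (\<FF> t)" using B_adapted that by (simp add: adapted_def)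
    show ?thesis by measurable
  qed
  then show ?thesis by (simp add: adapted_def free_path_def[abs_def])
qed

lemma free_path_cont: "\<omega> \<in> space M \<Longrightarrow> continuous_on {0..} (\<lambda>t. free_path t \<omega>)"
  unfolding free_path_def by (intro continuous_intros B_cont)

lemma free_path_0: "\<omega> \<in> space M \<Longrightarrow> free_path 0 \<omega> = x"
  by (simp add: free_path_def B_0)

lemma F0_mono: "mono F0"
  by (intro monoI mono_onD[OF F_mono]) auto

lemma state_eq:
  assumes "locally_integrable (\<lambda>s. l s \<omega>)" "0 \<le> t"
  shows "state B \<mu> \<sigma> x l G t \<omega> = path l \<omega> t + G t \<omega>"
proof -
  have "set_integrable lborel {0..t} (\<lambda>_. \<mu>)"
    by (rule borel_integrable_atLeastAtMost') (rule continuous_on_const)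
  then have "(LBINT s:{0..t}. \<mu> - l s \<omega>) = (LBINT s:{0..t}. \<mu>) - (LBINT s:{0..t}. l s \<omega>)"
    using assms by (intro set_integral_diff) auto
  moreover have "(LBINT s:{0..t}. \<mu>) = \<mu> * t"
    using assms(2) by (simp add: set_lebesgue_integral_def)
  ultimately show ?thesis by (simp add: state_def net_path_def free_path_def)
qed

lemma min_injection_eq:
  assumes "locally_integrable (\<lambda>s. l s \<omega>)"
  shows "min_injection B \<mu> \<sigma> x l t \<omega> = shortfall (path l \<omega>) t"
proof -
  have "(INF s\<in>{0..t}. min (state B \<mu> \<sigma> x l (\<lambda>_ _. 0) s \<omega>) 0) = (INF s\<in>{0..t}. min (path l \<omega> s) 0)"
    by (rule INF_cong) (simp_all add: state_eq[of l \<omega>, OF assms])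
  then show ?thesis by (simp add: min_injection_def shortfall_def)
qed

end

locale controlled_model = dividend_model +
  fixes l G :: "real \<Rightarrow> 'a \<Rightarrow> real"
  assumes control: "control M \<FF> l G"
begin

abbreviation T :: "'a \<Rightarrow> ennreal" where
  "T \<equiv> ruin_time B \<mu> \<sigma> x l G"

lemma l_prog: "progressively_measurable \<FF> l"
  and G_adapted: "adapted \<FF> G"
  using control by (auto simp: control_def)

context
  fixes \<omega> assumes \<omega>: "\<omega> \<in> space M"
begin

lemma l_int: "locally_integrable (\<lambda>s. l s \<omega>)"
  and G_neg: "t < 0 \<Longrightarrow> G t \<omega> = 0"
  and G_mono: "mono (\<lambda>t. G t \<omega>)"
  and G_right: "continuous (at_right t) (\<lambda>t. G t \<omega>)"
  using control \<omega> by (auto simp: control_def)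

lemma G_nonneg: "0 \<le> G t \<omega>"
proof -
  have "G (min t (- 1)) \<omega> \<le> G t \<omega>" by (rule monoD[OF G_mono]) simp
  then show ?thesis using G_neg[of "min t (- 1)"] by simp
qed

lemma state_l_eq: "0 \<le> t \<Longrightarrow> state B \<mu> \<sigma> x l G t \<omega> = path l \<omega> t + G t \<omega>"
  using l_int by (rule state_eq[of l \<omega>])

lemma path_cont: "continuous_on {0..} (path l \<omega>)"
  by (intro continuous_on_net_path free_path_cont \<omega> l_int)

text \<open>
  Strictly before ruin this is the definition. At the time of ruin it holds because the injections
  only jump up, so that the state is at least its left limit.
\<close>

lemma state_nonneg_until_ruin:
  assumes t: "0 \<le> t" "ennreal t \<le> T \<omega>"
  shows "0 \<le> state B \<mu> \<sigma> x l G t \<omega>"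
proof (cases "t = 0")
  case True
  then show ?thesis
    using x G_nonneg[of 0] by (simp add: state_l_eq net_path_at_0 free_path_0 \<omega>)
next
  case False
  have nonneg: "0 \<le> path l \<omega> s + G t \<omega>" if s: "s \<in> {0<..<t}" for s
  proof -
    have "0 \<le> state B \<mu> \<sigma> x l G s \<omega>"
    proof (rule ccontr)
      assume "\<not> 0 \<le> state B \<mu> \<sigma> x l G s \<omega>"
      then have "T \<omega> \<le> ennreal s"
        unfolding ruin_time_def using s by (intro INF_lower) auto
      with t(2) have "ennreal t \<le> ennreal s" by (rule order_trans)
      then show False using s by simp
    qed
    moreover have "G s \<omega> \<le> G t \<omega>" using s by (intro monoD[OF G_mono]) auto
    ultimately show ?thesis using s by (simp add: state_l_eq)
  qed
  have cl: "closure {0<..<t} = {0..t}" using t False by (intro closure_greaterThanLessThan) auto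
  have "0 \<le> path l \<omega> t + G t \<omega>"
  proof (rule continuous_ge_on_closure[where f = "\<lambda>s. path l \<omega> s + G t \<omega>" and S = "{0<..<t}"])
    show "continuous_on (closure {0<..<t}) (\<lambda>s. path l \<omega> s + G t \<omega>)"
      unfolding cl by (intro continuous_intros continuous_on_subset[OF path_cont]) auto
    show "t \<in> closure {0<..<t}" using t by (simp add: cl)
  qed (rule nonneg)
  then show ?thesis using t by (simp add: state_l_eq)
qed

text \<open>
  By right-continuity a negative state persists for a while, so ruin before \<open>u\<close> is seen at a rational
  time before \<open>u\<close>.
\<close>

lemma le_ruin_time_iff:
  assumes u: "0 \<le> u"
  shows "ennreal u \<le> T \<omega> \<longleftrightarrow> \<not> (\<exists>r\<in>\<rat> \<inter> {0<..<u}. state B \<mu> \<sigma> x l G r \<omega> < 0)"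
proof
  assume u_le: "ennreal u \<le> T \<omega>"
  show "\<not> (\<exists>r\<in>\<rat> \<inter> {0<..<u}. state B \<mu> \<sigma> x l G r \<omega> < 0)"
  proof
    assume "\<exists>r\<in>\<rat> \<inter> {0<..<u}. state B \<mu> \<sigma> x l G r \<omega> < 0"
    then obtain r where r: "0 < r" "r < u" "state B \<mu> \<sigma> x l G r \<omega> < 0" by auto
    have "ennreal r \<le> T \<omega>"
      using u_le r by (meson ennreal_leI less_imp_le order_trans)
    with state_nonneg_until_ruin[of r] r show False by simp
  qed
next
  assume no: "\<not> (\<exists>r\<in>\<rat> \<inter> {0<..<u}. state B \<mu> \<sigma> x l G r \<omega> < 0)"
  show "ennreal u \<le> T \<omega>"
  proof (rule ccontr)
    assume "\<not> ennreal u \<le> T \<omega>"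
    then obtain s where s: "0 < s" "state B \<mu> \<sigma> x l G s \<omega> < 0" "ennreal s < ennreal u"
      unfolding ruin_time_def by (auto simp: not_le INF_less_iff)
    then have su: "s < u" by (simp add: ennreal_less_iff)
    have "((\<lambda>t. path l \<omega> t + G t \<omega>) \<longlongrightarrow> path l \<omega> s + G s \<omega>) (at_right s)"
    proof (rule tendsto_add)
      have "continuous (at s within {0..}) (path l \<omega>)"
        using path_cont s by (simp add: continuous_on_eq_continuous_within)
      then have "(path l \<omega> \<longlongrightarrow> path l \<omega> s) (at s within {0..})"
        by (simp add: continuous_within)
      then show "(path l \<omega> \<longlongrightarrow> path l \<omega> s) (at_right s)"
        by (rule tendsto_within_subset) (use s in auto)
      show "((\<lambda>t. G t \<omega>) \<longlongrightarrow> G s \<omega>) (at_right s)"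
        using G_right[of s] by (simp add: continuous_within)
    qed
    moreover have "path l \<omega> s + G s \<omega> < 0" using s by (simp add: state_l_eq)
    ultimately have "\<forall>\<^sub>F t in at_right s. path l \<omega> t + G t \<omega> < 0"
      by (rule order_tendstoD(2))
    then obtain b where b: "s < b" "\<And>t. s < t \<Longrightarrow> t < b \<Longrightarrow> path l \<omega> t + G t \<omega> < 0"
      unfolding eventually_at_right_field by blast
    obtain r where "r \<in> \<rat>" "s < r" "r < min b u"
      using Rats_dense_in_real[of s "min b u"] b su by auto
    with b(2)[of r] no s show False by (auto simp: state_l_eq)
  qed
qed

end

lemma state_adapted:
  assumes "0 \<le> t"
  shows "state B \<mu> \<sigma> x l G t \<in> borel_measurable (\<FF> t)"
proof -
  have [measurable]: "free_path t \<in> borel_measurable (\<FF> t)" "G t \<in> borel_measurable (\<FF> t)"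
      "(\<lambda>\<omega>. LBINT s:{0..t}. l s \<omega>) \<in> borel_measurable (\<FF> t)"
    using free_path_adapted G_adapted adapted_LBINT[OF l_prog] assms by (auto simp: adapted_def)
  have "(\<lambda>\<omega>. free_path t \<omega> - (LBINT s:{0..t}. l s \<omega>) + G t \<omega>) \<in> borel_measurable (\<FF> t)"
    by measurable
  then show ?thesis
    by (rule measurable_cong[THEN iffD1, rotated])
       (simp add: space_filtration[OF filt] state_l_eq[OF _ assms] net_path_def)
qed

lemma ruin_time_pred:
  assumes "0 \<le> u"
  shows "Measurable.pred (\<FF> u) (\<lambda>\<omega>. ennreal u \<le> T \<omega>)"
proof -
  have "Measurable.pred (\<FF> u) (\<lambda>\<omega>. \<not> (\<exists>r\<in>\<rat> \<inter> {0<..<u}. state B \<mu> \<sigma> x l G r \<omega> < 0))"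
  proof (intro pred_intros_logic pred_countable_Bex)
    show "countable (\<rat> \<inter> {0<..<u} :: real set)" using countable_rat by auto
    fix r :: real assume r: "r \<in> \<rat> \<inter> {0<..<u}"
    then have [measurable]: "state B \<mu> \<sigma> x l G r \<in> borel_measurable (\<FF> u)"
      by (intro measurable_filtration_mono[OF filt _ state_adapted]) auto
    show "Measurable.pred (\<FF> u) (\<lambda>\<omega>. state B \<mu> \<sigma> x l G r \<omega> < 0)" by measurable
  qed
  then show ?thesis
    by (rule measurable_cong[THEN iffD1, rotated])
       (simp add: space_filtration[OF filt] le_ruin_time_iff assms)
qed

end

section \<open>The dividend rate of the improving strategy\<close>

locale admissible_strategy = controlled_model +
  assumes l_nonneg: "\<And>\<omega> t. \<omega> \<in> space M \<Longrightarrow> 0 \<le> t \<Longrightarrow> 0 \<le> l t \<omega>"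
    and l_le_F: "\<And>\<omega> t. \<omega> \<in> space M \<Longrightarrow> 0 \<le> t \<Longrightarrow> ennreal t \<le> ruin_time B \<mu> \<sigma> x l G \<omega> \<Longrightarrow>
      l t \<omega> \<le> F (state B \<mu> \<sigma> x l G t \<omega>)"
begin

text \<open>
  Dividends end with the ruin of the given strategy: later nothing is gained by them, and they could
  be inadmissible.
\<close>

definition cap :: "real \<Rightarrow> 'a \<Rightarrow> real" where
  "cap t \<omega> = (if ennreal t \<le> T \<omega> then l t \<omega> else 0)"

text \<open>
  The pairs of a time and a scenario with earlier ruin form a countable union of rectangles, one for
  each rational time at which the state can be seen to be negative.
\<close>

lemma cap_prog: "progressively_measurable \<FF> cap"
  unfolding progressively_measurable_def
proof (intro allI impI)
  fix t :: real assume t: "0 \<le> t"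
  let ?N = "restrict_space borel {0..t} \<Otimes>\<^sub>M \<FF> t"
  have l: "(\<lambda>(s, \<omega>). l s \<omega>) \<in> borel_measurable ?N"
    using l_prog t by (simp add: progressively_measurable_def)
  have "Measurable.pred ?N (\<lambda>p. \<not> (\<exists>r\<in>\<rat> \<inter> {0<..<t}. r < fst p \<and> state B \<mu> \<sigma> x l G r (snd p) < 0))"
  proof (intro pred_intros_logic pred_countable_Bex)
    show "countable (\<rat> \<inter> {0<..<t} :: real set)" using countable_rat by auto
    fix r :: real assume r: "r \<in> \<rat> \<inter> {0<..<t}"
    then have [measurable]: "state B \<mu> \<sigma> x l G r \<in> borel_measurable (\<FF> t)"
      by (intro measurable_filtration_mono[OF filt _ state_adapted]) auto
    show "Measurable.pred ?N (\<lambda>p. state B \<mu> \<sigma> x l G r (snd p) < 0)" by measurable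
    have [measurable]: "(\<lambda>s. s) \<in> restrict_space borel {0..t} \<rightarrow>\<^sub>M borel"
      by (intro measurable_restrict_space1) simp
    have [measurable]: "fst \<in> ?N \<rightarrow>\<^sub>M borel"
      using measurable_compose[OF measurable_fst, of "\<lambda>s. s" "restrict_space borel {0..t}" borel "\<FF> t"] by simp
    show "Measurable.pred ?N (\<lambda>p. r < fst p)" by measurable
  qed
  then have "(\<lambda>p. if \<not> (\<exists>r\<in>\<rat> \<inter> {0<..<t}. r < fst p \<and> state B \<mu> \<sigma> x l G r (snd p) < 0)
      then (\<lambda>(s, \<omega>). l s \<omega>) p else 0) \<in> borel_measurable ?N"
    using l by (intro measurable_If) (auto simp: pred_def)
  then show "(\<lambda>(s, \<omega>). cap s \<omega>) \<in> borel_measurable ?N"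
  proof (rule measurable_cong[THEN iffD1, rotated])
    fix p assume "p \<in> space ?N"
    then have p: "0 \<le> fst p" "fst p \<le> t" "snd p \<in> space M"
      by (auto simp: space_pair_measure space_restrict_space space_filtration[OF filt])
    have "ennreal (fst p) \<le> T (snd p) \<longleftrightarrow>
        \<not> (\<exists>r\<in>\<rat> \<inter> {0<..<t}. r < fst p \<and> state B \<mu> \<sigma> x l G r (snd p) < 0)"
      using le_ruin_time_iff[OF p(3,1)] p(2) by force
    then show "(if \<not> (\<exists>r\<in>\<rat> \<inter> {0<..<t}. r < fst p \<and> state B \<mu> \<sigma> x l G r (snd p) < 0)
        then (\<lambda>(s, \<omega>). l s \<omega>) p else 0) = (\<lambda>(s, \<omega>). cap s \<omega>) p"
      by (simp only: cap_def case_prod_beta)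
  qed
qed

lemma cap_bounds:
  assumes "\<omega> \<in> space M" "0 \<le> t"
  shows "0 \<le> cap t \<omega>" "cap t \<omega> \<le> l t \<omega>"
  using l_nonneg[OF assms] by (auto simp: cap_def)

lemma cap_int:
  assumes "\<omega> \<in> space M"
  shows "locally_integrable (\<lambda>s. cap s \<omega>)"
proof (intro allI impI)
  fix t :: real assume t: "0 \<le> t"
  show "set_integrable lborel {0..t} (\<lambda>s. cap s \<omega>)"
  proof (rule set_integrable_mono_bound)
    show "set_integrable lborel {0..t} (\<lambda>s. l s \<omega>)" using l_int[OF assms] t by auto
    show "set_borel_measurable lborel {0..t} (\<lambda>s. cap s \<omega>)"
      by (rule progressively_measurable_section[OF filt cap_prog t assms])
  qed (use cap_bounds[OF assms] in auto)
qed

sublocale capped_reflection_process M \<FF> F0 K free_path cap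
proof (rule capped_reflection_process.intro)
  show "filtered_prob_space M \<FF>" by (rule filt)
  show "adapted \<FF> free_path" by (rule free_path_adapted)
  show "progressively_measurable \<FF> cap" by (rule cap_prog)
  show "capped_reflection F0 K (\<lambda>t. free_path t \<omega>) (\<lambda>t. cap t \<omega>)" if "\<omega> \<in> space M" for \<omega>
    by unfold_locales (auto simp: K F_nonneg free_path_cont cap_bounds cap_int that)
qed

text \<open>
  The largest rate that is at most \<open>cap\<close> and allowed in the state kept nonnegative by
  minimal injections, and the process of these injections.
\<close>

definition rate :: "real \<Rightarrow> 'a \<Rightarrow> real" where
  "rate t \<omega> = capped_rate F0 (\<lambda>s. free_path s \<omega>) (\<lambda>s. cap s \<omega>) t"

definition minimal_capital :: "real \<Rightarrow> 'a \<Rightarrow> real" where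
  "minimal_capital t \<omega> = shortfall (path rate \<omega>) t"

lemma rate_prog: "progressively_measurable \<FF> rate"
  using progressively_measurable_capped_rate unfolding rate_def[abs_def] .

lemma
  assumes "\<omega> \<in> space M"
  shows rate_int: "locally_integrable (\<lambda>s. rate s \<omega>)"
    and rate_nonneg: "0 \<le> t \<Longrightarrow> 0 \<le> rate t \<omega>"
    and rate_le_cap: "0 \<le> t \<Longrightarrow> rate t \<omega> \<le> cap t \<omega>"
    and rate_fixpoint: "0 \<le> t \<Longrightarrow> rate t \<omega> = min (cap t \<omega>) (F0 (reflected (path rate \<omega>) t))"
    and path_rate_cont: "continuous_on {0..} (path rate \<omega>)"
proof -
  interpret capped_reflection F0 K "\<lambda>t. free_path t \<omega>" "\<lambda>t. cap t \<omega>"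
    by (rule path[OF assms])
  show int: "locally_integrable (\<lambda>s. rate s \<omega>)"
    unfolding rate_def by (rule capped_rate_integrable)
  show "0 \<le> t \<Longrightarrow> 0 \<le> rate t \<omega>" "0 \<le> t \<Longrightarrow> rate t \<omega> \<le> cap t \<omega>"
    unfolding rate_def by (rule capped_rate_bounds; assumption)+
  show "0 \<le> t \<Longrightarrow> rate t \<omega> = min (cap t \<omega>) (F0 (reflected (path rate \<omega>) t))"
    unfolding rate_def by (rule capped_rate_fixpoint)
  show "continuous_on {0..} (path rate \<omega>)"
    by (intro continuous_on_net_path z_cont int)
qed

lemma minimal_capital_adapted: "adapted \<FF> minimal_capital"
  unfolding minimal_capital_def[abs_def] by (rule adapted_shortfall_net_path[OF rate_prog rate_int])

lemma
  assumes "\<omega> \<in> space M"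
  shows minimal_capital_cont: "continuous_on {0..} (\<lambda>t. minimal_capital t \<omega>)"
    and minimal_capital_mono: "0 \<le> s \<Longrightarrow> s \<le> t \<Longrightarrow> minimal_capital s \<omega> \<le> minimal_capital t \<omega>"
    and minimal_capital_nonneg: "0 \<le> t \<Longrightarrow> 0 \<le> minimal_capital t \<omega>"
  unfolding minimal_capital_def
  using path_rate_cont[OF assms]
  by (auto intro: continuous_on_shortfall shortfall_mono shortfall_nonneg)

lemma reflected_le_state:
  assumes \<omega>: "\<omega> \<in> space M" and t: "0 \<le> t" "ennreal t \<le> T \<omega>"
  shows "path rate \<omega> t + minimal_capital t \<omega> \<le> path l \<omega> t + G t \<omega>"
proof -
  interpret capped_reflection F0 K "\<lambda>t. free_path t \<omega>" "\<lambda>t. cap t \<omega>"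
    by (rule path[OF \<omega>])
  have nonneg: "0 \<le> path l \<omega> s + G s \<omega>" if "0 \<le> s" "ennreal s \<le> T \<omega>" for s
    using state_nonneg_until_ruin[OF \<omega> that] by (simp add: state_l_eq[OF \<omega>] that)
  have "reflected (path rate \<omega>) t \<le> path l \<omega> t + G t \<omega>"
    unfolding rate_def
  proof (rule reflected_le_controlled[where T = "T \<omega>"])
    show "l s \<omega> \<le> F0 (path l \<omega> s + G s \<omega>)" if "0 \<le> s" "ennreal s \<le> T \<omega>" for s
      using l_le_F[OF \<omega> that] nonneg[OF that] that by (simp add: state_l_eq[OF \<omega>])
  qed (use F0_mono x l_int[OF \<omega>] G_mono[OF \<omega>] G_nonneg[OF \<omega>] nonneg t in
       \<open>auto simp: free_path_0 \<omega> cap_def\<close>)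
  then show ?thesis by (simp add: reflected_def minimal_capital_def)
qed

end

section \<open>Bail-out until a stopping time\<close>

text \<open>
  Injections at negative times vanish by convention, so that an injection at time \<open>0\<close> counts as a jump.
\<close>

definition (in admissible_strategy) injection_until :: "('a \<Rightarrow> ennreal) \<Rightarrow> real \<Rightarrow> 'a \<Rightarrow> real" where
  "injection_until \<tau> t \<omega> = (if t < 0 then 0 else minimal_capital (stopped (\<tau> \<omega>) t) \<omega>)"

text \<open>
  What a stopping time \<open>\<tau>\<close> must satisfy for the bail-out until \<open>\<tau>\<close> to lose little: the new strategy
  survives the given one, and the injections after the ruin time \<open>T\<close> of the latter cost at most \<open>\<beta> * \<epsilon>\<close>.
\<close>

locale stopped_bailout = admissible_strategy +
  fixes \<tau> :: "'a \<Rightarrow> ennreal" and \<epsilon> :: real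
  assumes \<tau>: "ext_stopping_time \<FF> \<tau>"
    and T_le_\<tau>: "\<And>\<omega>. \<omega> \<in> space M \<Longrightarrow> T \<omega> \<le> \<tau> \<omega>"
    and \<epsilon>: "0 \<le> \<epsilon>"
    and excess: "\<And>\<omega> u. \<omega> \<in> space M \<Longrightarrow> 0 \<le> u \<Longrightarrow> ennreal u \<le> \<tau> \<omega> \<Longrightarrow>
      minimal_capital u \<omega> \<le> minimal_capital (stopped (T \<omega>) u) \<omega> + \<epsilon>"
begin

abbreviation G' :: "real \<Rightarrow> 'a \<Rightarrow> real" where
  "G' \<equiv> injection_until \<tau>"

abbreviation T' :: "'a \<Rightarrow> ennreal" where
  "T' \<equiv> ruin_time B \<mu> \<sigma> x rate G'"

lemma G'_control: "control M \<FF> rate G'"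
  unfolding control_def
proof (intro conjI ballI)
  show "progressively_measurable \<FF> rate" by (rule rate_prog)
  have "adapted \<FF> (\<lambda>t \<omega>. minimal_capital (stopped (\<tau> \<omega>) t) \<omega>)"
    by (rule adapted_stopped[OF filt minimal_capital_adapted ext_stopping_time_pred_ge[OF filt \<tau>]
        minimal_capital_cont minimal_capital_mono])
  then show "adapted \<FF> G'"
    by (simp add: adapted_def injection_until_def[abs_def])
  fix \<omega> assume \<omega>: "\<omega> \<in> space M"
  show "locally_integrable (\<lambda>s. rate s \<omega>)" by (rule rate_int[OF \<omega>])
  show "\<forall>t<0. G' t \<omega> = 0" by (simp add: injection_until_def)
  show "mono (\<lambda>t. G' t \<omega>)"
    using minimal_capital_nonneg[OF \<omega> stopped_nonneg] minimal_capital_mono[OF \<omega> stopped_nonneg stopped_mono]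
    by (intro monoI) (auto simp: injection_until_def)
  show "\<forall>t. continuous (at_right t) (\<lambda>t. G' t \<omega>)"
  proof
    fix t :: real
    show "continuous (at_right t) (\<lambda>t. G' t \<omega>)"
    proof (cases "t < 0")
      case True
      then have "\<forall>\<^sub>F s in at_right t. s \<in> {t<..<0}"
        by (rule eventually_at_right_real)
      then have "\<forall>\<^sub>F s in at_right t. G' s \<omega> = G' t \<omega>"
        by eventually_elim (use True in \<open>auto simp: injection_until_def\<close>)
      then show ?thesis
        unfolding continuous_within by (rule tendsto_eventually)
    next
      case False
      have "continuous_on {0..} (\<lambda>t. minimal_capital (stopped (\<tau> \<omega>) t) \<omega>)"
        by (rule continuous_on_compose2[OF minimal_capital_cont[OF \<omega>] continuous_on_stopped])
           (auto simp: stopped_nonneg)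
      then have "continuous_on {0..} (\<lambda>t. G' t \<omega>)"
        by (rule continuous_on_eq) (simp add: injection_until_def)
      then have "continuous (at t within {0..}) (\<lambda>t. G' t \<omega>)"
        using False by (simp add: continuous_on_eq_continuous_within)
      then show ?thesis
        by (rule continuous_within_subset) (use False in auto)
    qed
  qed
qed

context
  fixes \<omega> assumes \<omega>: "\<omega> \<in> space M"
begin

lemma state'_eq: "0 \<le> t \<Longrightarrow> state B \<mu> \<sigma> x rate G' t \<omega> = path rate \<omega> t + minimal_capital (stopped (\<tau> \<omega>) t) \<omega>"
  using state_eq[of rate \<omega> t G', OF rate_int[OF \<omega>]] by (simp add: injection_until_def)

lemma state'_before_\<tau>:
  assumes t: "0 \<le> t" "ennreal t \<le> \<tau> \<omega>"
  shows "state B \<mu> \<sigma> x rate G' t \<omega> = reflected (path rate \<omega>) t"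
    and "0 \<le> state B \<mu> \<sigma> x rate G' t \<omega>"
  using reflected_nonneg[OF path_rate_cont[OF \<omega>] t(1)]
  by (simp_all add: state'_eq stopped_before t minimal_capital_def reflected_def)

lemma \<tau>_le_T': "\<tau> \<omega> \<le> T' \<omega>"
  unfolding ruin_time_def
proof (rule INF_greatest, clarify)
  fix s :: real assume s: "0 < s" "state B \<mu> \<sigma> x rate G' s \<omega> < 0"
  then show "\<tau> \<omega> \<le> ennreal s"
    using state'_before_\<tau>(2)[of s] by (meson less_imp_le linorder_not_less nle_le)
qed

end

lemma rate_zero_after_ruin:
  assumes "\<omega> \<in> space M" "0 \<le> t" "\<not> ennreal t \<le> T \<omega>"
  shows "rate t \<omega> = 0"
  using rate_nonneg[OF assms(1,2)] rate_le_cap[OF assms(1,2)] assms(3) by (simp add: cap_def)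

lemma state'_nonneg_until_ruin:
  assumes "\<omega> \<in> space M" "0 \<le> t" "ennreal t \<le> T' \<omega>"
  shows "0 \<le> state B \<mu> \<sigma> x rate G' t \<omega>"
proof -
  interpret new: controlled_model M \<FF> B \<mu> \<sigma> q \<beta> K F x rate G'
    by unfold_locales (rule G'_control)
  show ?thesis using assms by (rule new.state_nonneg_until_ruin)
qed

text \<open>
  Until \<open>\<tau>\<close> the state is the reflected path for which the rate was constructed; afterwards the rate is
  \<open>0\<close>, and \<open>F\<close> is nonnegative at the state, which is nonnegative until ruin.
\<close>

lemma rate_injection_admissible: "(rate, G') \<in> admissible M \<FF> B \<mu> \<sigma> F x"
  unfolding admissible_def
proof (safe intro!: G'_control)
  fix \<omega> t assume \<omega>: "\<omega> \<in> space M" and t: "0 \<le> (t::real)"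
  show "0 \<le> rate t \<omega>" by (rule rate_nonneg[OF \<omega> t])
  assume T': "ennreal t \<le> T' \<omega>"
  show "rate t \<omega> \<le> F (state B \<mu> \<sigma> x rate G' t \<omega>)"
  proof (cases "ennreal t \<le> \<tau> \<omega>")
    case True
    then show ?thesis
      using rate_fixpoint[OF \<omega> t] state'_before_\<tau>[OF \<omega> t True] by simp
  next
    case False
    then have "\<not> ennreal t \<le> T \<omega>" using T_le_\<tau>[OF \<omega>] by (meson order_trans)
    then have "rate t \<omega> = 0" by (rule rate_zero_after_ruin[OF \<omega> t])
    then show ?thesis
      using F_nonneg state'_nonneg_until_ruin[OF \<omega> t T'] by simp
  qed
qed

lemma rate_injection_bailout: "(rate, G') \<in> bailout M \<FF> B \<mu> \<sigma> F x"
proof -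
  have "G' t \<omega> = min_injection B \<mu> \<sigma> x rate (enn2real (min (ennreal t) (\<tau> \<omega>))) \<omega>"
    if "\<omega> \<in> space M" "0 \<le> t" for \<omega> t
    using that by (simp add: min_injection_eq[of rate \<omega>, OF rate_int] injection_until_def minimal_capital_def stopped_def)
  then show ?thesis
    using rate_injection_admissible \<tau> unfolding bailout_def by blast
qed

lemma G'_le_minimal:
  assumes \<omega>: "\<omega> \<in> space M" and s: "0 \<le> s"
  shows "G' (stopped S s) \<omega> \<le> minimal_capital (stopped (T \<omega>) s) \<omega> + \<epsilon>"
proof -
  let ?v = "stopped (\<tau> \<omega>) (stopped S s)"
  have "G' (stopped S s) \<omega> = minimal_capital ?v \<omega>"
    using stopped_nonneg[of S s] by (simp add: injection_until_def)
  also have "\<dots> \<le> minimal_capital (stopped (T \<omega>) ?v) \<omega> + \<epsilon>"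
    by (rule excess[OF \<omega> stopped_nonneg stopped_le_time])
  also have "stopped (T \<omega>) ?v \<le> stopped (T \<omega>) s"
    using stopped_le[OF stopped_nonneg, of "\<tau> \<omega>" S s] stopped_le[OF s, of S]
    by (intro stopped_mono) linarith
  then have "minimal_capital (stopped (T \<omega>) ?v) \<omega> \<le> minimal_capital (stopped (T \<omega>) s) \<omega>"
    by (rule minimal_capital_mono[OF \<omega> stopped_nonneg])
  finally show ?thesis by simp
qed

text \<open>
  The budget inequality \<open>L + G' \<le> L' + G\<close> holds up to \<open>T\<close> as a reformulation of
  \<open>reflected_le_state\<close>. After \<open>T\<close> the given strategy is no longer rewarded or charged, and the new
  one spends at most another \<open>\<epsilon>\<close>.
\<close>

lemma payoff_le:
  assumes \<omega>: "\<omega> \<in> space M"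
  shows "net_payoff q \<beta> l G (T \<omega>) \<omega> \<le> net_payoff q \<beta> rate G' (T' \<omega>) \<omega> + ereal (\<beta> * \<epsilon>)"
proof (rule net_payoff_le)
  show "locally_integrable (\<lambda>t. l t \<omega>)" "\<And>t. 0 \<le> t \<Longrightarrow> 0 \<le> l t \<omega>"
    by (rule l_int[OF \<omega>] l_nonneg[OF \<omega>]; assumption)+
  show "locally_integrable (\<lambda>t. rate t \<omega>)" "\<And>t. 0 \<le> t \<Longrightarrow> 0 \<le> rate t \<omega>"
    by (rule rate_int[OF \<omega>] rate_nonneg[OF \<omega>]; assumption)+
  show "mono (\<lambda>t. G t \<omega>)" "\<And>t. continuous (at_right t) (\<lambda>t. G t \<omega>)" "\<And>t. t < 0 \<Longrightarrow> G t \<omega> = 0"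
    by (rule G_mono[OF \<omega>] G_right[OF \<omega>] G_neg[OF \<omega>]; assumption)+
  show "mono (\<lambda>t. G' t \<omega>)" "\<And>t. continuous (at_right t) (\<lambda>t. G' t \<omega>)" "\<And>t. t < 0 \<Longrightarrow> G' t \<omega> = 0"
    using G'_control \<omega> by (simp_all add: control_def)
  fix s :: real assume s: "0 \<le> s"
  let ?u = "stopped (T \<omega>) s" and ?v = "stopped (T' \<omega>) s"
  have "T \<omega> \<le> T' \<omega>" using T_le_\<tau>[OF \<omega>] \<tau>_le_T'[OF \<omega>] by (rule order_trans)
  then have uv: "?u \<le> ?v" by (rule stopped_mono_time)
  have budget: "(LBINT r:{0..?u}. l r \<omega>) + minimal_capital ?u \<omega> \<le> (LBINT r:{0..?u}. rate r \<omega>) + G ?u \<omega>"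
    using reflected_le_state[OF \<omega> stopped_nonneg[of "T \<omega>" s] stopped_le_time] by (simp add: net_path_def)
  have G'_le: "G' ?v \<omega> \<le> minimal_capital ?u \<omega> + \<epsilon>" by (rule G'_le_minimal[OF \<omega> s])
  have "(LBINT r:{0..?u}. rate r \<omega>) \<le> (LBINT r:{0..?v}. rate r \<omega>)"
    by (rule LBINT_mono_interval[OF rate_int[OF \<omega>] rate_nonneg[OF \<omega>] stopped_nonneg uv])
  with budget G'_le show "(LBINT r:{0..?u}. l r \<omega>) + G' ?v \<omega> \<le> (LBINT r:{0..?v}. rate r \<omega>) + G ?u \<omega> + \<epsilon>"
    by linarith
  have "(LBINT r:{0..?u}. rate r \<omega>) \<le> (LBINT r:{0..?u}. l r \<omega>)"
  proof (rule set_integral_mono)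
    show "set_integrable lborel {0..?u} (\<lambda>r. rate r \<omega>)" "set_integrable lborel {0..?u} (\<lambda>r. l r \<omega>)"
      using rate_int[OF \<omega>] l_int[OF \<omega>] stopped_nonneg by auto
    show "rate r \<omega> \<le> l r \<omega>" if "r \<in> {0..?u}" for r
      using rate_le_cap[OF \<omega>, of r] cap_bounds(2)[OF \<omega>, of r] that by simp
  qed
  with budget G'_le show "G' ?v \<omega> \<le> G ?u \<omega> + \<epsilon>"
    by linarith
qed (use q \<beta> \<epsilon> in auto)

end

context admissible_strategy
begin

text \<open>
  The time at which a bail-out without end would have injected \<open>\<epsilon>\<close> after the ruin of the given
  strategy.
\<close>

definition excess_time :: "real \<Rightarrow> 'a \<Rightarrow> ennreal" where
  "excess_time \<epsilon> \<omega> =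
     (INF t\<in>{t. 0 \<le> t \<and> \<epsilon> \<le> minimal_capital t \<omega> - minimal_capital (stopped (T \<omega>) t) \<omega>}. ennreal t)"

lemma minimal_capital_stopped_adapted: "adapted \<FF> (\<lambda>t \<omega>. minimal_capital (stopped (T \<omega>) t) \<omega>)"
  by (rule adapted_stopped[OF filt minimal_capital_adapted ruin_time_pred minimal_capital_cont minimal_capital_mono])

context
  fixes \<omega> assumes \<omega>: "\<omega> \<in> space M"
begin

abbreviation excess_at :: "real \<Rightarrow> real" where
  "excess_at t \<equiv> minimal_capital t \<omega> - minimal_capital (stopped (T \<omega>) t) \<omega>"

lemma excess_cont: "continuous_on {0..} excess_at"
proof -
  have "continuous_on {0..} (\<lambda>t. minimal_capital (stopped (T \<omega>) t) \<omega>)"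
    by (rule continuous_on_compose2[OF minimal_capital_cont[OF \<omega>] continuous_on_stopped]) (auto simp: stopped_nonneg)
  then show ?thesis by (intro continuous_intros minimal_capital_cont[OF \<omega>])
qed

lemma excess_before_ruin: "0 \<le> t \<Longrightarrow> ennreal t \<le> T \<omega> \<Longrightarrow> excess_at t = 0"
  by (simp add: stopped_before)

lemma excess_mono:
  assumes "0 \<le> s" "s \<le> t"
  shows "excess_at s \<le> excess_at t"
proof (cases "ennreal s \<le> T \<omega>")
  case True
  have "minimal_capital (stopped (T \<omega>) t) \<omega> \<le> minimal_capital t \<omega>"
    using assms by (intro minimal_capital_mono[OF \<omega> stopped_nonneg] stopped_le) auto
  then show ?thesis using excess_before_ruin[OF assms(1) True] by simp
next
  case False
  then have "\<not> ennreal t \<le> T \<omega>"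
    using assms by (meson ennreal_leI order_trans)
  then show ?thesis
    using minimal_capital_mono[OF \<omega> assms] False assms by (simp add: stopped_after)
qed

text \<open>
  The excess is continuous and nondecreasing, so its value at \<open>t\<close> decides whether the level \<open>\<epsilon>\<close> has been
  reached by time \<open>t\<close>. This is what makes \<open>excess_time \<epsilon>\<close> a stopping time although \<open>T\<close> is not one in general.
\<close>

lemma excess_time_le_iff:
  assumes \<epsilon>: "0 < \<epsilon>" and t: "0 \<le> t"
  shows "excess_time \<epsilon> \<omega> \<le> ennreal t \<longleftrightarrow> \<epsilon> \<le> excess_at t"
proof
  assume "\<epsilon> \<le> excess_at t"
  then show "excess_time \<epsilon> \<omega> \<le> ennreal t"
    unfolding excess_time_def using t by (intro INF_lower) simp
next
  assume le: "excess_time \<epsilon> \<omega> \<le> ennreal t"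
  show "\<epsilon> \<le> excess_at t"
  proof (rule ccontr)
    assume "\<not> \<epsilon> \<le> excess_at t"
    then have pos: "0 < \<epsilon> - excess_at t" by simp
    obtain \<delta> where \<delta>: "0 < \<delta>"
      "\<And>s. 0 \<le> s \<Longrightarrow> dist s t < \<delta> \<Longrightarrow> dist (excess_at s) (excess_at t) < \<epsilon> - excess_at t"
      using excess_cont t pos unfolding continuous_on_iff by (metis atLeast_iff)
    have "ennreal (t + \<delta>) \<le> excess_time \<epsilon> \<omega>"
      unfolding excess_time_def
    proof (rule INF_greatest, clarify)
      fix s assume s: "0 \<le> s" "\<epsilon> \<le> excess_at s"
      have "t < s"
        using excess_mono[of s t] s pos by (meson linorder_not_less order_trans diff_gt_0_iff_gt)
      moreover have "\<not> dist s t < \<delta>"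
        using \<delta>(2)[OF s(1)] s(2) by (auto simp: dist_real_def)
      ultimately show "ennreal (t + \<delta>) \<le> ennreal s"
        by (intro ennreal_leI) (auto simp: dist_real_def)
    qed
    then have "ennreal (t + \<delta>) \<le> ennreal t" using le by (rule order_trans)
    with t \<delta>(1) show False by simp
  qed
qed

lemma ruin_le_excess_time:
  assumes "0 < \<epsilon>"
  shows "T \<omega> \<le> excess_time \<epsilon> \<omega>"
  unfolding excess_time_def
proof (rule INF_greatest, clarify)
  fix t assume t: "0 \<le> t" "\<epsilon> \<le> excess_at t"
  then show "T \<omega> \<le> ennreal t"
    using excess_before_ruin[of t] assms by (cases "ennreal t \<le> T \<omega>") auto
qed

lemma excess_until_excess_time:
  assumes \<epsilon>: "0 < \<epsilon>" and u: "0 \<le> u" "ennreal u \<le> excess_time \<epsilon> \<omega>"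
  shows "excess_at u \<le> \<epsilon>"
proof (cases "u = 0")
  case True
  then show ?thesis using \<epsilon> by (simp add: stopped_def)
next
  case False
  have before: "excess_at s \<le> \<epsilon>" if s: "s \<in> {0<..<u}" for s
  proof (rule ccontr)
    assume "\<not> excess_at s \<le> \<epsilon>"
    then have "excess_time \<epsilon> \<omega> \<le> ennreal s"
      using excess_time_le_iff[OF \<epsilon>, of s] s by simp
    with u(2) have "ennreal u \<le> ennreal s" by (rule order_trans)
    then show False using s by simp
  qed
  have cl: "closure {0<..<u} = {0..u}"
    using u False by (intro closure_greaterThanLessThan) auto
  show ?thesis
  proof (rule continuous_le_on_closure[where f = excess_at and S = "{0<..<u}"])
    show "continuous_on (closure {0<..<u}) excess_at"
      unfolding cl by (rule continuous_on_subset[OF excess_cont]) auto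
    show "u \<in> closure {0<..<u}" using u by (simp add: cl)
  qed (rule before)
qed

end

lemma excess_time_stopping:
  assumes "0 < \<epsilon>"
  shows "ext_stopping_time \<FF> (excess_time \<epsilon>)"
  unfolding ext_stopping_time_def
proof (intro allI impI)
  fix t :: real assume t: "0 \<le> t"
  have [measurable]: "minimal_capital t \<in> borel_measurable (\<FF> t)"
      "(\<lambda>\<omega>. minimal_capital (stopped (T \<omega>) t) \<omega>) \<in> borel_measurable (\<FF> t)"
    using minimal_capital_adapted minimal_capital_stopped_adapted t by (auto simp: adapted_def)
  have "Measurable.pred (\<FF> t) (\<lambda>\<omega>. \<epsilon> \<le> minimal_capital t \<omega> - minimal_capital (stopped (T \<omega>) t) \<omega>)"
    by measurable
  then show "Measurable.pred (\<FF> t) (\<lambda>\<omega>. excess_time \<epsilon> \<omega> \<le> ennreal t)"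
    by (rule measurable_cong[THEN iffD1, rotated])
       (simp add: space_filtration[OF filt] excess_time_le_iff assms t)
qed

lemma stopped_bailout_excess_time:
  assumes "0 < \<epsilon>"
  shows "stopped_bailout M \<FF> B \<mu> \<sigma> q \<beta> K F x l G (excess_time \<epsilon>) \<epsilon>"
proof unfold_locales
  show "ext_stopping_time \<FF> (excess_time \<epsilon>)" by (rule excess_time_stopping[OF assms])
  show "T \<omega> \<le> excess_time \<epsilon> \<omega>" if "\<omega> \<in> space M" for \<omega>
    by (rule ruin_le_excess_time[OF that assms])
  show "minimal_capital u \<omega> \<le> minimal_capital (stopped (T \<omega>) u) \<omega> + \<epsilon>"
    if "\<omega> \<in> space M" "0 \<le> u" "ennreal u \<le> excess_time \<epsilon> \<omega>" for \<omega> u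
    using excess_until_excess_time[OF that(1) assms that(2,3)] by simp
qed (use assms in simp)

text \<open>
  A strategy without ruin needs no approximation: the bail-out may go on forever.
\<close>

lemma stopped_bailout_never:
  assumes "\<And>\<omega>. \<omega> \<in> space M \<Longrightarrow> T \<omega> = \<infinity>"
  shows "stopped_bailout M \<FF> B \<mu> \<sigma> q \<beta> K F x l G (\<lambda>_. \<infinity>) 0"
  by unfold_locales (auto simp: ext_stopping_time_def assms stopped_before)

end

section \<open>Value functions\<close>

lemma (in dividend_model) admissible_strategyI:
  assumes "(l, G) \<in> admissible M \<FF> B \<mu> \<sigma> F x"
  shows "admissible_strategy M \<FF> B \<mu> \<sigma> q \<beta> K F x l G"
  by unfold_locales (use assms in \<open>auto simp: admissible_def\<close>)

lemma (in dividend_model) value_fn_eq: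
  "value_fn M \<FF> B \<mu> \<sigma> q \<beta> F x = (SUP (l, G)\<in>bailout M \<FF> B \<mu> \<sigma> F x. performance M B \<mu> \<sigma> q \<beta> x l G)"
    (is "_ = ?S")
proof (rule antisym)
  show "value_fn M \<FF> B \<mu> \<sigma> q \<beta> F x \<le> ?S"
    unfolding value_fn_def
  proof (rule SUP_least, clarify)
    fix l G assume "(l, G) \<in> admissible M \<FF> B \<mu> \<sigma> F x"
    then interpret admissible_strategy M \<FF> B \<mu> \<sigma> q \<beta> K F x l G
      by (rule admissible_strategyI)
    show "performance M B \<mu> \<sigma> q \<beta> x l G \<le> ?S"
    proof (rule ereal_le_epsilon)
      fix e :: ereal assume e: "0 < e"
      show "performance M B \<mu> \<sigma> q \<beta> x l G \<le> ?S + e"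
      proof (cases e)
        case (real r)
        \<comment> \<open>the payoff loses at most \<open>\<beta> * \<epsilon>\<close> on each path, and the expectation at most twice as much\<close>
        define \<epsilon> where "\<epsilon> = r / (2 * \<beta>)"
        have \<epsilon>_pos: "0 < \<epsilon>" and two_eps: "2 * (\<beta> * \<epsilon>) = r"
          using e real \<beta> by (auto simp: \<epsilon>_def)
        interpret stopped_bailout M \<FF> B \<mu> \<sigma> q \<beta> K F x l G "excess_time \<epsilon>" \<epsilon>
          by (rule stopped_bailout_excess_time[OF \<epsilon>_pos])
        have "performance M B \<mu> \<sigma> q \<beta> x l G
            \<le> performance M B \<mu> \<sigma> q \<beta> x rate (injection_until (excess_time \<epsilon>)) + ereal (2 * (\<beta> * \<epsilon>))"
          unfolding performance_def
          using \<beta> \<epsilon>_pos by (intro ereal_expectation_le_add[OF prob_space_M] payoff_le) auto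
        also have "\<dots> \<le> ?S + e"
          unfolding two_eps real
          using SUP_upper[OF rate_injection_bailout, of "\<lambda>(l, G). performance M B \<mu> \<sigma> q \<beta> x l G"]
          by (intro add_mono) simp_all
        finally show ?thesis .
      qed (use e in auto)
    qed
  qed
  show "?S \<le> value_fn M \<FF> B \<mu> \<sigma> q \<beta> F x"
    unfolding value_fn_def by (intro SUP_subset_mono) (auto simp: bailout_def)
qed

lemma ruin_time_infinity:
  assumes "\<And>t. 0 \<le> t \<Longrightarrow> 0 \<le> state B \<mu> \<sigma> x l G t \<omega>"
  shows "ruin_time B \<mu> \<sigma> x l G \<omega> = \<infinity>"
proof -
  have "{t. 0 < t \<and> state B \<mu> \<sigma> x l G t \<omega> < 0} = {}"
    by (auto dest: assms[OF less_imp_le])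
  then show ?thesis by (simp add: ruin_time_def)
qed

lemma performance_no_ruin:
  assumes "(l, G) \<in> admissible_c M \<FF> B \<mu> \<sigma> F x"
  shows "performance M B \<mu> \<sigma> q \<beta> x l G = ereal_expectation M (\<lambda>\<omega>. net_payoff q \<beta> l G \<infinity> \<omega>)"
proof -
  have "net_payoff q \<beta> l G (ruin_time B \<mu> \<sigma> x l G \<omega>) \<omega> = net_payoff q \<beta> l G \<infinity> \<omega>" if "\<omega> \<in> space M" for \<omega>
    using assms that by (subst ruin_time_infinity) (auto simp: admissible_c_def)
  then show ?thesis
    unfolding performance_def ereal_expectation_def by (simp cong: nn_integral_cong)
qed

lemma (in dividend_model) value_fn_c_eq:
  "value_fn_c M \<FF> B \<mu> \<sigma> q \<beta> F x = (SUP (l, G)\<in>bailout_c M \<FF> B \<mu> \<sigma> F x. performance M B \<mu> \<sigma> q \<beta> x l G)"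
    (is "_ = ?S")
proof (rule antisym)
  show "value_fn_c M \<FF> B \<mu> \<sigma> q \<beta> F x \<le> ?S"
    unfolding value_fn_c_def
  proof (rule SUP_least, clarify)
    fix l G assume lG: "(l, G) \<in> admissible_c M \<FF> B \<mu> \<sigma> F x"
    then have "(l, G) \<in> admissible M \<FF> B \<mu> \<sigma> F x" by (simp add: admissible_c_def)
    then interpret admissible_strategy M \<FF> B \<mu> \<sigma> q \<beta> K F x l G
      by (rule admissible_strategyI)
    have "T \<omega> = \<infinity>" if "\<omega> \<in> space M" for \<omega>
      using lG that by (intro ruin_time_infinity) (auto simp: admissible_c_def)
    then interpret stopped_bailout M \<FF> B \<mu> \<sigma> q \<beta> K F x l G "\<lambda>_. \<infinity>" 0
      by (rule stopped_bailout_never)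
    have "performance M B \<mu> \<sigma> q \<beta> x l G
        \<le> performance M B \<mu> \<sigma> q \<beta> x rate (injection_until (\<lambda>_. \<infinity>)) + ereal (2 * (\<beta> * 0))"
      unfolding performance_def
      by (intro ereal_expectation_le_add[OF prob_space_M] payoff_le) auto
    also have "\<dots> = performance M B \<mu> \<sigma> q \<beta> x rate (injection_until (\<lambda>_. \<infinity>))"
      by simp
    also have "\<dots> \<le> ?S"
    proof -
      have "0 \<le> state B \<mu> \<sigma> x rate (injection_until (\<lambda>_. \<infinity>)) t \<omega>" if "\<omega> \<in> space M" "0 \<le> t" for \<omega> t
        by (rule state'_before_\<tau>(2)[OF that]) simp
      moreover have "injection_until (\<lambda>_. \<infinity>) t \<omega> = min_injection B \<mu> \<sigma> x rate t \<omega>"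
        if "\<omega> \<in> space M" "0 \<le> t" for \<omega> t
        using that by (simp add: injection_until_def stopped_before minimal_capital_def
            min_injection_eq[of rate \<omega>, OF rate_int])
      ultimately have "(rate, injection_until (\<lambda>_. \<infinity>)) \<in> bailout_c M \<FF> B \<mu> \<sigma> F x"
        using rate_injection_admissible by (simp add: bailout_c_def admissible_c_def)
      from SUP_upper[OF this, of "\<lambda>(l, G). performance M B \<mu> \<sigma> q \<beta> x l G"]
      show ?thesis by simp
    qed
    finally show "performance M B \<mu> \<sigma> q \<beta> x l G \<le> ?S" .
  qed
  show "?S \<le> value_fn_c M \<FF> B \<mu> \<sigma> q \<beta> F x"
    unfolding value_fn_c_def by (intro SUP_subset_mono) (auto simp: bailout_c_def)
qed

theorem proposition2:
  fixes M :: "'a measure" and \<FF> :: "real \<Rightarrow> 'a measure" and B :: "real \<Rightarrow> 'a \<Rightarrow> real"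
    and \<mu> \<sigma> q \<beta> :: real and F :: "real \<Rightarrow> real"
  assumes "filtered_prob_space M \<FF>"
    and "brownian_motion M \<FF> B"
    and "\<sigma> > 0" and "q > 0" and "\<beta> > 1"
    and "\<And>y. y \<ge> 0 \<Longrightarrow> F y \<ge> 0"
    and "mono_on {0..} F" and "concave_on {0..} F" and "C1_on_nonneg F"
  shows "\<forall>x\<ge>0.
      value_fn_c M \<FF> B \<mu> \<sigma> q \<beta> F x =
        (SUP (l, G)\<in>bailout_c M \<FF> B \<mu> \<sigma> F x.
           ereal_expectation M (\<lambda>\<omega>. net_payoff q \<beta> l G \<infinity> \<omega>)) \<and>
      value_fn M \<FF> B \<mu> \<sigma> q \<beta> F x =
        (SUP (l, G)\<in>bailout M \<FF> B \<mu> \<sigma> F x.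
           ereal_expectation M (\<lambda>\<omega>. net_payoff q \<beta> l G (ruin_time B \<mu> \<sigma> x l G \<omega>) \<omega>))"
proof (intro allI impI)
  fix x :: real assume x: "x \<ge> 0"
  obtain K where K: "0 < K" "\<And>y z. \<bar>F (max 0 y) - F (max 0 z)\<bar> \<le> K * \<bar>y - z\<bar>"
    using concave_mono_C1_lipschitz[OF assms(7-9)] by blast
  interpret dividend_model M \<FF> B \<mu> \<sigma> q \<beta> K F x
    using assms x K by unfold_locales (auto simp: brownian_motion_def)
  have "(SUP (l, G)\<in>bailout_c M \<FF> B \<mu> \<sigma> F x. performance M B \<mu> \<sigma> q \<beta> x l G) =
      (SUP (l, G)\<in>bailout_c M \<FF> B \<mu> \<sigma> F x. ereal_expectation M (\<lambda>\<omega>. net_payoff q \<beta> l G \<infinity> \<omega>))"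
    by (rule SUP_cong) (auto simp: bailout_c_def performance_no_ruin)
  then show "value_fn_c M \<FF> B \<mu> \<sigma> q \<beta> F x =
        (SUP (l, G)\<in>bailout_c M \<FF> B \<mu> \<sigma> F x.
           ereal_expectation M (\<lambda>\<omega>. net_payoff q \<beta> l G \<infinity> \<omega>)) \<and>
      value_fn M \<FF> B \<mu> \<sigma> q \<beta> F x =
        (SUP (l, G)\<in>bailout M \<FF> B \<mu> \<sigma> F x.
           ereal_expectation M (\<lambda>\<omega>. net_payoff q \<beta> l G (ruin_time B \<mu> \<sigma> x l G \<omega>) \<omega>))"
    using value_fn_c_eq value_fn_eq by (simp add: performance_def)
qed

end
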